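(* There exists a morphism of simplicial sets which is a monomorphism, bijective on $0$-simplices, and a weak categorical equivalence, but which is not inner anodyne.
   Context: A morphism of simplicial sets is inner anodyne if it belongs to the saturated class generated by the inner horn inclusions $\Lambda^n_k \to \Delta^n$, $0<k<n$ (the smallest class containing them and closed under pushouts, coproducts, transfinite composition and retracts); equivalently, if it is a retract of a countable composite of pushouts of coproducts of inner horn inclusions. A quasi-category is a simplicial set $X$ such that every morphism $\Lambda^n_k \to X$ with $0<k<n$ extends along $\Lambda^n_k \to \Delta^n$. Joyal's model structure for quasi-categories is the (unique) model structure on the category of simplicial sets whose cofibrations are the monomorphisms and whose fibrant objects are the quasi-categories. A weak categorical equivalence is a weak equivalence in this model structure. *)

theory Defs
  imports Main "HOL-Library.FuncSet"
begin

section \<open>Categories\<close>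

record ('o, 'm) category =
  Ob :: "'o set"
  Ar :: "'m set"
  Dom :: "'m \<Rightarrow> 'o"
  Cod :: "'m \<Rightarrow> 'o"
  Idn :: "'o \<Rightarrow> 'm"
  Comp :: "'m \<Rightarrow> 'm \<Rightarrow> 'm" (infixl "\<cdot>\<index>" 70)

definition hom :: "('o, 'm) category \<Rightarrow> 'o \<Rightarrow> 'o \<Rightarrow> 'm set" where
  "hom C X Y = {f \<in> Ar C. Dom C f = X \<and> Cod C f = Y}"

definition is_category :: "('o, 'm) category \<Rightarrow> bool" where
  "is_category C \<longleftrightarrow>
     (\<forall>f \<in> Ar C. Dom C f \<in> Ob C \<and> Cod C f \<in> Ob C) \<and>
     (\<forall>X \<in> Ob C. Idn C X \<in> hom C X X) \<and>
     (\<forall>X Y Z. \<forall>f \<in> hom C X Y. \<forall>g \<in> hom C Y Z. g \<cdot>\<^bsub>C\<^esub> f \<in> hom C X Z) \<and>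
     (\<forall>X Y. \<forall>f \<in> hom C X Y. f \<cdot>\<^bsub>C\<^esub> Idn C X = f \<and> Idn C Y \<cdot>\<^bsub>C\<^esub> f = f) \<and>
     (\<forall>X Y Z W. \<forall>f \<in> hom C X Y. \<forall>g \<in> hom C Y Z. \<forall>h \<in> hom C Z W.
        h \<cdot>\<^bsub>C\<^esub> (g \<cdot>\<^bsub>C\<^esub> f) = (h \<cdot>\<^bsub>C\<^esub> g) \<cdot>\<^bsub>C\<^esub> f)"

definition monomorphism :: "('o, 'm) category \<Rightarrow> 'm \<Rightarrow> bool" where
  "monomorphism C f \<longleftrightarrow> f \<in> Ar C \<and>
     (\<forall>Z. \<forall>g \<in> hom C Z (Dom C f). \<forall>h \<in> hom C Z (Dom C f).
        f \<cdot>\<^bsub>C\<^esub> g = f \<cdot>\<^bsub>C\<^esub> h \<longrightarrow> g = h)"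

definition terminal :: "('o, 'm) category \<Rightarrow> 'o \<Rightarrow> bool" where
  "terminal C T \<longleftrightarrow> T \<in> Ob C \<and> (\<forall>X \<in> Ob C. \<exists>!f. f \<in> hom C X T)"

definition is_pushout :: "('o, 'm) category \<Rightarrow> 'm \<Rightarrow> 'm \<Rightarrow> 'm \<Rightarrow> 'm \<Rightarrow> bool" where
  \<comment> \<open>\<open>j : X \<rightarrow> Y\<close> is the pushout of \<open>i : A \<rightarrow> B\<close> along \<open>u : A \<rightarrow> X\<close>, with second coprojection
     \<open>v : B \<rightarrow> Y\<close>\<close>
  "is_pushout C i u j v \<longleftrightarrow>
     (\<exists>A B X Y. i \<in> hom C A B \<and> u \<in> hom C A X \<and> j \<in> hom C X Y \<and> v \<in> hom C B Y \<and>
        j \<cdot>\<^bsub>C\<^esub> u = v \<cdot>\<^bsub>C\<^esub> i \<and>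
        (\<forall>Z. \<forall>p \<in> hom C X Z. \<forall>q \<in> hom C B Z. p \<cdot>\<^bsub>C\<^esub> u = q \<cdot>\<^bsub>C\<^esub> i \<longrightarrow>
           (\<exists>!h. h \<in> hom C Y Z \<and> h \<cdot>\<^bsub>C\<^esub> j = p \<and> h \<cdot>\<^bsub>C\<^esub> v = q)))"

definition is_coproduct ::
    "('o, 'm) category \<Rightarrow> 'i set \<Rightarrow> ('i \<Rightarrow> 'o) \<Rightarrow> 'o \<Rightarrow> ('i \<Rightarrow> 'm) \<Rightarrow> bool" where
  "is_coproduct C I A P a \<longleftrightarrow> P \<in> Ob C \<and>
     (\<forall>i \<in> I. A i \<in> Ob C \<and> a i \<in> hom C (A i) P) \<and>
     (\<forall>Z \<in> Ob C. \<forall>q. (\<forall>i \<in> I. q i \<in> hom C (A i) Z) \<longrightarrow>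
        (\<exists>!h. h \<in> hom C P Z \<and> (\<forall>i \<in> I. h \<cdot>\<^bsub>C\<^esub> a i = q i)))"

definition coproduct_arrow ::
    "('o, 'm) category \<Rightarrow> 'i set \<Rightarrow> ('i \<Rightarrow> 'm) \<Rightarrow> 'm \<Rightarrow> bool" where
  "coproduct_arrow C I g f \<longleftrightarrow> f \<in> Ar C \<and> (\<forall>i \<in> I. g i \<in> Ar C) \<and>
     (\<exists>a b. is_coproduct C I (\<lambda>i. Dom C (g i)) (Dom C f) a \<and>
            is_coproduct C I (\<lambda>i. Cod C (g i)) (Cod C f) b \<and>
            (\<forall>i \<in> I. f \<cdot>\<^bsub>C\<^esub> a i = b i \<cdot>\<^bsub>C\<^esub> g i))"

definition retract_of :: "('o, 'm) category \<Rightarrow> 'm \<Rightarrow> 'm \<Rightarrow> bool" where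
  \<comment> \<open>\<open>f\<close> is a retract of \<open>g\<close> in the category of arrows\<close>
  "retract_of C f g \<longleftrightarrow>
     (\<exists>A B X Y s r s' r'. f \<in> hom C A B \<and> g \<in> hom C X Y \<and>
        s \<in> hom C A X \<and> r \<in> hom C X A \<and> s' \<in> hom C B Y \<and> r' \<in> hom C Y B \<and>
        r \<cdot>\<^bsub>C\<^esub> s = Idn C A \<and> r' \<cdot>\<^bsub>C\<^esub> s' = Idn C B \<and>
        g \<cdot>\<^bsub>C\<^esub> s = s' \<cdot>\<^bsub>C\<^esub> f \<and> f \<cdot>\<^bsub>C\<^esub> r = r' \<cdot>\<^bsub>C\<^esub> g)"


subsection \<open>Transfinite composition\<close>

text \<open>An ordinal is represented by a well-order \<open>r\<close> (reflexive, as in the library) on \<open>Field r\<close>.\<close>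

definition is_chain ::
    "('o, 'm) category \<Rightarrow> 'i rel \<Rightarrow> ('i \<Rightarrow> 'o) \<Rightarrow> ('i \<Rightarrow> 'i \<Rightarrow> 'm) \<Rightarrow> bool" where
  "is_chain C r X D \<longleftrightarrow>
     (\<forall>a \<in> Field r. X a \<in> Ob C \<and> D a a = Idn C (X a)) \<and>
     (\<forall>a b. (a, b) \<in> r \<longrightarrow> D a b \<in> hom C (X a) (X b)) \<and>
     (\<forall>a b c. (a, b) \<in> r \<longrightarrow> (b, c) \<in> r \<longrightarrow> D b c \<cdot>\<^bsub>C\<^esub> D a b = D a c)"

definition chain_cocone ::
    "('o, 'm) category \<Rightarrow> 'i rel \<Rightarrow> ('i \<Rightarrow> 'o) \<Rightarrow> ('i \<Rightarrow> 'i \<Rightarrow> 'm) \<Rightarrow> 'i set \<Rightarrow>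
     'o \<Rightarrow> ('i \<Rightarrow> 'm) \<Rightarrow> bool" where
  "chain_cocone C r X D I T t \<longleftrightarrow> T \<in> Ob C \<and> (\<forall>a \<in> I. t a \<in> hom C (X a) T) \<and>
     (\<forall>a \<in> I. \<forall>b \<in> I. (a, b) \<in> r \<longrightarrow> t b \<cdot>\<^bsub>C\<^esub> D a b = t a)"

definition chain_colimit ::
    "('o, 'm) category \<Rightarrow> 'i rel \<Rightarrow> ('i \<Rightarrow> 'o) \<Rightarrow> ('i \<Rightarrow> 'i \<Rightarrow> 'm) \<Rightarrow> 'i set \<Rightarrow>
     'o \<Rightarrow> ('i \<Rightarrow> 'm) \<Rightarrow> bool" where
  "chain_colimit C r X D I T t \<longleftrightarrow> chain_cocone C r X D I T t \<and>
     (\<forall>Z q. chain_cocone C r X D I Z q \<longrightarrow>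
        (\<exists>!h. h \<in> hom C T Z \<and> (\<forall>a \<in> I. h \<cdot>\<^bsub>C\<^esub> t a = q a)))"

definition below :: "'i rel \<Rightarrow> 'i \<Rightarrow> 'i set" where
  "below r b = {a. (a, b) \<in> r \<and> a \<noteq> b}"

definition successor_of :: "'i rel \<Rightarrow> 'i \<Rightarrow> 'i \<Rightarrow> bool" where
  "successor_of r a b \<longleftrightarrow> a \<in> below r b \<and> (\<forall>c \<in> below r b. (c, a) \<in> r)"

definition limit_elem :: "'i rel \<Rightarrow> 'i \<Rightarrow> bool" where
  "limit_elem r b \<longleftrightarrow> b \<in> Field r \<and> below r b \<noteq> {} \<and> (\<nexists>a. successor_of r a b)"

definition transfinite_composite ::
    "('o, 'm) category \<Rightarrow> 'm set \<Rightarrow> 'i rel \<Rightarrow> ('i \<Rightarrow> 'o) \<Rightarrow> ('i \<Rightarrow> 'i \<Rightarrow> 'm) \<Rightarrow> 'm \<Rightarrow> bool" where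
  \<comment> \<open>\<open>f\<close> is a composite \<open>X 0 \<rightarrow> colim X\<close> of a colimit-preserving chain whose successor steps
     lie in \<open>S\<close>\<close>
  "transfinite_composite C S r X D f \<longleftrightarrow>
     Well_order r \<and> is_chain C r X D \<and>
     (\<forall>a b. successor_of r a b \<longrightarrow> D a b \<in> S) \<and>
     (\<forall>b. limit_elem r b \<longrightarrow> chain_colimit C r X D (below r b) (X b) (\<lambda>a. D a b)) \<and>
     (\<exists>T t z. chain_colimit C r X D (Field r) T t \<and>
        z \<in> Field r \<and> below r z = {} \<and> f = t z)"


subsection \<open>Saturated classes\<close>

text \<open>
  Coproducts are indexed by sets of elements of, and chains by well-orders on subsets of, the type
  of arrows. For the category of simplicial sets over a type \<open>'u\<close> defined below this type has at
  least as many elements as there are subsets of \<open>'u\<close> (if \<open>'u\<close> is infinite), while a simplicial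
  set has at most as many simplices as \<open>'u\<close> has elements, so that larger index sets would not
  yield any further arrows.
\<close>

definition saturated :: "('o, 'm) category \<Rightarrow> 'm set \<Rightarrow> bool" where
  "saturated C S \<longleftrightarrow> S \<subseteq> Ar C \<and>
     (\<forall>i u j v. i \<in> S \<longrightarrow> is_pushout C i u j v \<longrightarrow> j \<in> S) \<and>
     (\<forall>(I :: 'm set) g f. (\<forall>i \<in> I. g i \<in> S) \<longrightarrow> coproduct_arrow C I g f \<longrightarrow> f \<in> S) \<and>
     (\<forall>(r :: 'm rel) X D f. transfinite_composite C S r X D f \<longrightarrow> f \<in> S) \<and>
     (\<forall>f g. g \<in> S \<longrightarrow> retract_of C f g \<longrightarrow> f \<in> S)"

definition saturated_hull :: "('o, 'm) category \<Rightarrow> 'm set \<Rightarrow> 'm set" where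
  "saturated_hull C G = \<Inter> {S. saturated C S \<and> G \<subseteq> S}"


subsection \<open>Model structures\<close>

definition has_lifting :: "('o, 'm) category \<Rightarrow> 'm \<Rightarrow> 'm \<Rightarrow> bool" where
  "has_lifting C i p \<longleftrightarrow>
     (\<forall>u \<in> hom C (Dom C i) (Dom C p). \<forall>v \<in> hom C (Cod C i) (Cod C p).
        p \<cdot>\<^bsub>C\<^esub> u = v \<cdot>\<^bsub>C\<^esub> i \<longrightarrow>
        (\<exists>h \<in> hom C (Cod C i) (Dom C p). h \<cdot>\<^bsub>C\<^esub> i = u \<and> p \<cdot>\<^bsub>C\<^esub> h = v))"

definition two_out_of_three :: "('o, 'm) category \<Rightarrow> 'm set \<Rightarrow> bool" where
  "two_out_of_three C W \<longleftrightarrow>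
     (\<forall>X Y Z. \<forall>f \<in> hom C X Y. \<forall>g \<in> hom C Y Z.
        (f \<in> W \<longrightarrow> g \<in> W \<longrightarrow> g \<cdot>\<^bsub>C\<^esub> f \<in> W) \<and>
        (f \<in> W \<longrightarrow> g \<cdot>\<^bsub>C\<^esub> f \<in> W \<longrightarrow> g \<in> W) \<and>
        (g \<in> W \<longrightarrow> g \<cdot>\<^bsub>C\<^esub> f \<in> W \<longrightarrow> f \<in> W))"

definition has_factorization :: "('o, 'm) category \<Rightarrow> 'm set \<Rightarrow> 'm set \<Rightarrow> bool" where
  "has_factorization C L R \<longleftrightarrow>
     (\<forall>f \<in> Ar C. \<exists>Z. \<exists>i \<in> L \<inter> hom C (Dom C f) Z. \<exists>p \<in> R \<inter> hom C Z (Cod C f). f = p \<cdot>\<^bsub>C\<^esub> i)"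

definition model_structure ::
    "('o, 'm) category \<Rightarrow> 'm set \<Rightarrow> 'm set \<Rightarrow> 'm set \<Rightarrow> bool" where
  \<comment> \<open>weak equivalences \<open>W\<close>, cofibrations \<open>K\<close>, fibrations \<open>F\<close>\<close>
  "model_structure C W K F \<longleftrightarrow>
     W \<subseteq> Ar C \<and> K \<subseteq> Ar C \<and> F \<subseteq> Ar C \<and>
     two_out_of_three C W \<and>
     (\<forall>S \<in> {W, K, F}. \<forall>f g. g \<in> S \<longrightarrow> retract_of C f g \<longrightarrow> f \<in> S) \<and>
     (\<forall>i \<in> K \<inter> W. \<forall>p \<in> F. has_lifting C i p) \<and>
     (\<forall>i \<in> K. \<forall>p \<in> F \<inter> W. has_lifting C i p) \<and>
     has_factorization C (K \<inter> W) F \<and>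
     has_factorization C K (F \<inter> W)"

definition fibrant :: "('o, 'm) category \<Rightarrow> 'm set \<Rightarrow> 'o \<Rightarrow> bool" where
  "fibrant C F X \<longleftrightarrow> X \<in> Ob C \<and> (\<exists>T t. terminal C T \<and> t \<in> hom C X T \<and> t \<in> F)"


section \<open>Simplicial sets\<close>

text \<open>
  A monotone map \<open>\<theta> : [m] \<rightarrow> [n]\<close> is represented by the list \<open>[\<theta> 0, \<dots>, \<theta> m]\<close>; the composite
  \<open>\<theta> \<circ> \<phi>\<close> is then \<open>map (nth \<theta>) \<phi>\<close>.
\<close>

definition ord_maps :: "nat \<Rightarrow> nat \<Rightarrow> nat list set" where
  "ord_maps m n = {\<theta>. length \<theta> = Suc m \<and> sorted \<theta> \<and> set \<theta> \<subseteq> {0..n}}"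

text \<open>
  In a simplicial set \<open>X\<close>, the map \<open>\<theta>\<^sup>* : X\<^sub>n \<rightarrow> X\<^sub>m\<close> induced by \<open>\<theta> : [m] \<rightarrow> [n]\<close> is \<open>act X n \<theta>\<close>; \<open>n\<close> has
  to be supplied, since neither the list \<open>\<theta>\<close> nor a simplex determines it. The values of \<open>act\<close>
  outside the sets of simplices are irrelevant: objects that differ only there are isomorphic.
\<close>

record 'a sset =
  simplices :: "nat \<Rightarrow> 'a set"
  act :: "nat \<Rightarrow> nat list \<Rightarrow> 'a \<Rightarrow> 'a"

definition is_sset :: "'a sset \<Rightarrow> bool" where
  "is_sset X \<longleftrightarrow>
     (\<forall>m n. \<forall>\<theta> \<in> ord_maps m n. \<forall>x \<in> simplices X n. act X n \<theta> x \<in> simplices X m) \<and>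
     (\<forall>n. \<forall>x \<in> simplices X n. act X n [0..<Suc n] x = x) \<and>
     (\<forall>l m n. \<forall>\<phi> \<in> ord_maps l m. \<forall>\<theta> \<in> ord_maps m n. \<forall>x \<in> simplices X n.
        act X n (map (nth \<theta>) \<phi>) x = act X m \<phi> (act X n \<theta> x))"

definition sset_map :: "'a sset \<Rightarrow> 'b sset \<Rightarrow> (nat \<Rightarrow> 'a \<Rightarrow> 'b) \<Rightarrow> bool" where
  "sset_map X Y f \<longleftrightarrow>
     (\<forall>n. f n \<in> simplices X n \<rightarrow>\<^sub>E simplices Y n) \<and>
     (\<forall>m n. \<forall>\<theta> \<in> ord_maps m n. \<forall>x \<in> simplices X n. f m (act X n \<theta> x) = act Y n \<theta> (f n x))"

definition sset_iso :: "'a sset \<Rightarrow> 'b sset \<Rightarrow> (nat \<Rightarrow> 'a \<Rightarrow> 'b) \<Rightarrow> bool" where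
  "sset_iso X Y f \<longleftrightarrow> sset_map X Y f \<and> (\<forall>n. bij_betw (f n) (simplices X n) (simplices Y n))"

definition std_simplex :: "nat \<Rightarrow> nat list sset" where
  "std_simplex n = \<lparr>simplices = (\<lambda>m. ord_maps m n), act = (\<lambda>_ \<theta> x. map (nth x) \<theta>)\<rparr>"

definition horn :: "nat \<Rightarrow> nat \<Rightarrow> nat list sset" where
  "horn n k = \<lparr>simplices = (\<lambda>m. {x \<in> ord_maps m n. \<exists>j \<in> {0..n}. j \<noteq> k \<and> j \<notin> set x}),
               act = (\<lambda>_ \<theta> x. map (nth x) \<theta>)\<rparr>"

definition quasi_category :: "'a sset \<Rightarrow> bool" where
  "quasi_category X \<longleftrightarrow> is_sset X \<and>
     (\<forall>n k f. 0 < k \<longrightarrow> k < n \<longrightarrow> sset_map (horn n k) X f \<longrightarrow>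
        (\<exists>g. sset_map (std_simplex n) X g \<and>
             (\<forall>m. \<forall>x \<in> simplices (horn n k) m. g m x = f m x)))"


subsection \<open>The category of simplicial sets\<close>

record 'a smap =
  src :: "'a sset"
  trg :: "'a sset"
  fn :: "nat \<Rightarrow> 'a \<Rightarrow> 'a"

text \<open>The elements of the type \<open>'u\<close> serve as the universe from which simplices are taken.\<close>

definition sSet :: "('u sset, 'u smap) category" where
  "sSet =
     \<lparr>Ob = {X. is_sset X},
      Ar = {f. is_sset (src f) \<and> is_sset (trg f) \<and> sset_map (src f) (trg f) (fn f)},
      Dom = src,
      Cod = trg,
      Idn = (\<lambda>X. \<lparr>src = X, trg = X, fn = (\<lambda>n. restrict (\<lambda>x. x) (simplices X n))\<rparr>),
      Comp = (\<lambda>g f. \<lparr>src = src f, trg = trg g,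
                     fn = (\<lambda>n. compose (simplices (src f) n) (fn g n) (fn f n))\<rparr>)\<rparr>"

definition bijective_on_vertices :: "'u smap \<Rightarrow> bool" where
  "bijective_on_vertices f \<longleftrightarrow> bij_betw (fn f 0) (simplices (src f) 0) (simplices (trg f) 0)"

text \<open>
  Since \<open>std_simplex n\<close> has simplices of type \<open>nat list\<close> rather than \<open>'u\<close>, the inner horn
  inclusions enter \<open>sSet\<close> through all their isomorphic copies.
\<close>

definition inner_horn_inclusions :: "'u smap set" where
  "inner_horn_inclusions =
     {i \<in> Ar sSet. \<exists>n k a b. 0 < k \<and> k < n \<and>
        sset_iso (horn n k) (src i) a \<and> sset_iso (std_simplex n) (trg i) b \<and>
        (\<forall>m. \<forall>x \<in> simplices (horn n k) m. fn i m (a m x) = b m x)}"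

definition inner_anodyne :: "'u smap \<Rightarrow> bool" where
  "inner_anodyne f \<longleftrightarrow> f \<in> saturated_hull sSet inner_horn_inclusions"

definition joyal_model_structure :: "'u smap set \<Rightarrow> 'u smap set \<Rightarrow> 'u smap set \<Rightarrow> bool" where
  "joyal_model_structure W K F \<longleftrightarrow>
     model_structure sSet W K F \<and>
     K = {f. monomorphism sSet f} \<and>
     (\<forall>X \<in> Ob sSet. fibrant sSet F X \<longleftrightarrow> quasi_category X)"

definition large_universe :: "'u itself \<Rightarrow> bool" where
  "large_universe _ \<longleftrightarrow> infinite (UNIV :: 'u set) \<and> (\<exists>e :: (nat \<Rightarrow> 'u) \<Rightarrow> 'u. inj e)"

text \<open>
  By a theorem of Joyal there is exactly one such model structure on the category of all simplicial
  sets. It restricts to the simplicial sets over \<open>'u\<close> if \<open>'u\<close> is a large universe, that is,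
  infinite of cardinality \<open>\<kappa> = \<kappa>\<^sup>\<omega>\<close>: its trivial cofibrations are generated by those between
  countable simplicial sets, so that the small object argument does not leave this cardinality. It
  remains unique there, because a model structure on a category with finite limits and colimits is
  determined by its cofibrations and fibrant objects. The quantifier below therefore ranges over
  exactly one triple and refers to that one.
\<close>

definition weak_categorical_equivalence :: "'u smap \<Rightarrow> bool" where
  "weak_categorical_equivalence f \<longleftrightarrow>
     f \<in> Ar sSet \<and> (\<forall>W K F. joyal_model_structure W K F \<longrightarrow> f \<in> W)"


subsection \<open>Well-definedness\<close>

lemma ord_maps_comp:
  assumes "\<phi> \<in> ord_maps l m" "\<theta> \<in> ord_maps m n"
  shows "map (nth \<theta>) \<phi> \<in> ord_maps l n"
proof -
  have len: "length \<phi> = Suc l" "length \<theta> = Suc m" and sp: "sorted \<phi>" and st: "sorted \<theta>"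
    and bp: "set \<phi> \<subseteq> {0..m}" and bt: "set \<theta> \<subseteq> {0..n}"
    using assms by (auto simp: ord_maps_def)
  have lt: "\<phi> ! j < length \<theta>" if "j < length \<phi>" for j
    using bp len nth_mem[OF that] by (auto simp: less_Suc_eq_le)
  have "sorted (map (nth \<theta>) \<phi>)"
    unfolding sorted_iff_nth_mono
    using lt sp st by (auto simp: sorted_iff_nth_mono)
  moreover have "set (map (nth \<theta>) \<phi>) \<subseteq> {0..n}"
    using lt bt by (force simp: in_set_conv_nth subset_iff)
  ultimately show ?thesis
    using len by (simp add: ord_maps_def)
qed

lemma map_nth_map:
  assumes "\<phi> \<in> ord_maps l m" "length \<theta> = Suc m"
  shows "map (nth x) (map (nth \<theta>) \<phi>) = map (nth (map (nth x) \<theta>)) \<phi>"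
  using assms by (auto simp: ord_maps_def less_Suc_eq_le subset_iff)

lemma map_nth_id: "x \<in> ord_maps m n \<Longrightarrow> map (nth x) [0..<Suc m] = x"
  using map_nth[of x] by (simp add: ord_maps_def)

lemma ord_maps_length: "x \<in> ord_maps m n \<Longrightarrow> length x = Suc m"
  by (simp add: ord_maps_def)

lemma is_sset_std_simplex: "is_sset (std_simplex n)"
  unfolding is_sset_def std_simplex_def sset.simps
  by (intro conjI allI ballI map_nth_id map_nth_map) (auto intro: ord_maps_comp ord_maps_length)

lemma set_map_nth_subset:
  assumes "\<theta> \<in> ord_maps l m" "x \<in> ord_maps m n"
  shows "set (map (nth x) \<theta>) \<subseteq> set x"
proof -
  have "i < length x" if "i \<in> set \<theta>" for i
    using assms that by (auto simp: ord_maps_def less_Suc_eq_le)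
  then show ?thesis by auto
qed

lemma is_sset_horn: "is_sset (horn n k)"
  unfolding is_sset_def horn_def sset.simps
proof (intro conjI allI ballI)
  fix m m' \<theta> x
  assume "\<theta> \<in> ord_maps m m'" "x \<in> {x \<in> ord_maps m' n. \<exists>j\<in>{0..n}. j \<noteq> k \<and> j \<notin> set x}"
  then show "map (nth x) \<theta> \<in> {x \<in> ord_maps m n. \<exists>j\<in>{0..n}. j \<noteq> k \<and> j \<notin> set x}"
    using ord_maps_comp[of \<theta> m m' x n] set_map_nth_subset[of \<theta> m m' x n] by blast
next
  fix m x assume "x \<in> {x \<in> ord_maps m n. \<exists>j\<in>{0..n}. j \<noteq> k \<and> j \<notin> set x}"
  then show "map (nth x) [0..<Suc m] = x" using map_nth_id[of x m n] by blast
next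
  fix l m m' \<phi> \<theta> and x :: "nat list"
  assume "\<phi> \<in> ord_maps l m" "\<theta> \<in> ord_maps m m'"
  then show "map (nth x) (map (nth \<theta>) \<phi>) = map (nth (map (nth x) \<theta>)) \<phi>"
    by (blast intro: map_nth_map ord_maps_length)
qed

lemma is_category_sSet: "is_category (sSet :: ('u sset, 'u smap) category)"
proof -
  have ext: "f = g" if "src f = src g" "trg f = trg g" "\<And>n. fn f n = fn g n" for f g :: "'u smap"
    using that by (cases f; cases g) auto
  have comp: "sset_map X Z (\<lambda>n. compose (simplices X n) (g n) (f n))"
    if "sset_map X Y f" "sset_map Y Z g" "is_sset X" for X Y Z :: "'u sset" and f g
  proof -
    have "compose (simplices X n) (g n) (f n) \<in> simplices X n \<rightarrow>\<^sub>E simplices Z n" for n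
      using that by (auto simp: sset_map_def compose_def PiE_iff)
    then show ?thesis
      using that by (auto simp: sset_map_def compose_def is_sset_def PiE_iff)
  qed
  have idm: "sset_map X X (\<lambda>n. restrict (\<lambda>x. x) (simplices X n))" if "is_sset X"
    for X :: "'u sset"
    using that by (auto simp: sset_map_def is_sset_def)
  show ?thesis
    unfolding is_category_def
  proof (intro conjI allI ballI)
    fix f :: "'u smap" and X Y
    assume f: "f \<in> hom sSet X Y"
    then have e: "fn f n \<in> simplices X n \<rightarrow>\<^sub>E simplices Y n" for n
      by (auto simp: hom_def sSet_def sset_map_def)
    have 1: "compose (simplices X n) (fn f n) (restrict (\<lambda>x. x) (simplices X n)) = fn f n"
      and 2: "compose (simplices X n) (restrict (\<lambda>x. x) (simplices Y n)) (fn f n) = fn f n" for n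
      using e[of n]
      by (auto simp: compose_def fun_eq_iff PiE_iff extensional_def)
    show "f \<cdot>\<^bsub>sSet\<^esub> Idn sSet X = f" and "Idn sSet Y \<cdot>\<^bsub>sSet\<^esub> f = f"
      using f 1 2 by (auto simp: hom_def sSet_def intro!: ext)
  next
    fix X Y Z V and f g h :: "'u smap"
    assume "f \<in> hom sSet X Y" "g \<in> hom sSet Y Z" "h \<in> hom sSet Z V"
    then show "h \<cdot>\<^bsub>sSet\<^esub> (g \<cdot>\<^bsub>sSet\<^esub> f) = (h \<cdot>\<^bsub>sSet\<^esub> g) \<cdot>\<^bsub>sSet\<^esub> f"
      by (auto simp: hom_def sSet_def sset_map_def compose_def fun_eq_iff PiE_iff intro!: ext)
  qed (auto simp: hom_def sSet_def intro: comp idm)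
qed

end

theory Submission
  imports Defs "HOL-Library.Nat_Bijection"
begin

text \<open>
  Let \<open>J\<close> be the nerve of the groupoid with two uniquely isomorphic objects \<open>0 \<cong> 1\<close>. The example is the
  inclusion \<open>A \<rightarrow> B\<close> where \<open>A\<close> is the outer horn \<open>\<Lambda>\<^sup>2\<^sub>0\<close> with its edge \<open>01\<close> enlarged to \<open>J\<close>, and \<open>B\<close> is
  obtained from \<open>A\<close> by filling this horn. All simplicial sets that occur lie in the nerve \<open>N\<close> of the
  category \<open>(0 \<cong> 1) \<rightarrow> 2\<close>, or in its product with \<open>J\<close>, where a simplex is determined by its
  vertices; they are treated as sets of words.

  \<open>A \<rightarrow> B\<close> is not inner anodyne, because it is an inner fibration without being an
  isomorphism: a simplex of \<open>B\<close> outside \<open>A\<close> contains the edge \<open>12\<close>, and then so does each of its inner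
  horns (\<open>inner_horn_detects_horn_shape\<close>). The maps that lift against a given monomorphism form a
  saturated class (\<open>saturated_lifting_mono\<close>), so an inner anodyne map lifts against \<open>A \<rightarrow> B\<close>; but
  \<open>A \<rightarrow> B\<close> does not lift against itself.

  \<open>A \<rightarrow> B\<close> is a weak categorical equivalence, because \<open>A \<rightarrow> N\<close> and \<open>B \<rightarrow> N\<close> both arise by filling inner
  horns, one in each dimension from some dimension on. Hence maps from \<open>A\<close> or \<open>B\<close> to a
  quasi-category extend to \<open>N\<close> (\<open>extend_stage\<close>). In \<open>N\<close> the identity is homotopic to the
  retraction onto the interval \<open>02\<close> that sends \<open>1\<close> to \<open>0\<close>, and this homotopy can be transported to
  fibrant replacements of \<open>A\<close> and of \<open>B\<close> (\<open>arrow_inclusion_weq\<close>). It follows that the inclusions of the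
  interval \<open>02\<close> into \<open>A\<close> and into \<open>B\<close> are weak equivalences, and so is \<open>A \<rightarrow> B\<close> by two out of three.
  The cylinders are products with \<open>J\<close>. Their projections are trivial fibrations in any model structure
  whose cofibrations are the monomorphisms, since a map into \<open>J\<close> is just a function on vertices and
  extends along every monomorphism (\<open>cylinder_projection_lifting\<close>).
\<close>

section \<open>Lifting against a monomorphism\<close>

lemma hom_comp:
  "is_category C \<Longrightarrow> f \<in> hom C X Y \<Longrightarrow> g \<in> hom C Y Z \<Longrightarrow> g \<cdot>\<^bsub>C\<^esub> f \<in> hom C X Z"
  by (auto simp: is_category_def)

lemma hom_assoc:
  "is_category C \<Longrightarrow> f \<in> hom C X Y \<Longrightarrow> g \<in> hom C Y Z \<Longrightarrow> h \<in> hom C Z W \<Longrightarrow>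
   (h \<cdot>\<^bsub>C\<^esub> g) \<cdot>\<^bsub>C\<^esub> f = h \<cdot>\<^bsub>C\<^esub> (g \<cdot>\<^bsub>C\<^esub> f)"
  unfolding is_category_def by metis

lemma hom_id:
  assumes "is_category C" "f \<in> hom C X Y"
  shows "f \<cdot>\<^bsub>C\<^esub> Idn C X = f" "Idn C Y \<cdot>\<^bsub>C\<^esub> f = f"
  using assms unfolding is_category_def by blast+

lemma id_hom: "is_category C \<Longrightarrow> X \<in> Ob C \<Longrightarrow> Idn C X \<in> hom C X X"
  by (auto simp: is_category_def)

lemma hom_Ob: "is_category C \<Longrightarrow> f \<in> hom C X Y \<Longrightarrow> X \<in> Ob C \<and> Y \<in> Ob C"
  by (auto simp: is_category_def hom_def)

lemma hom_Ar: "f \<in> hom C X Y \<Longrightarrow> f \<in> Ar C"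
  by (simp add: hom_def)

lemma mono_cancel:
  assumes "monomorphism C p" "p \<in> hom C P Q" "g \<in> hom C Z P" "h \<in> hom C Z P"
    "p \<cdot>\<^bsub>C\<^esub> g = p \<cdot>\<^bsub>C\<^esub> h"
  shows "g = h"
  using assms by (auto simp: monomorphism_def hom_def)

lemma liftingD:
  assumes "has_lifting C i p" "i \<in> hom C A B" "p \<in> hom C P Q"
    "u \<in> hom C A P" "v \<in> hom C B Q" "p \<cdot>\<^bsub>C\<^esub> u = v \<cdot>\<^bsub>C\<^esub> i"
  obtains h where "h \<in> hom C B P" "h \<cdot>\<^bsub>C\<^esub> i = u" "p \<cdot>\<^bsub>C\<^esub> h = v"
  using assms by (auto simp: has_lifting_def hom_def)

lemma liftingI:
  assumes "i \<in> hom C A B" "p \<in> hom C P Q"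
    and "\<And>u v. u \<in> hom C A P \<Longrightarrow> v \<in> hom C B Q \<Longrightarrow> p \<cdot>\<^bsub>C\<^esub> u = v \<cdot>\<^bsub>C\<^esub> i \<Longrightarrow>
      \<exists>h \<in> hom C B P. h \<cdot>\<^bsub>C\<^esub> i = u \<and> p \<cdot>\<^bsub>C\<^esub> h = v"
  shows "has_lifting C i p"
proof -
  have "Dom C i = A" "Cod C i = B" "Dom C p = P" "Cod C p = Q"
    using assms(1,2) by (auto simp: hom_def)
  with assms(3) show ?thesis by (auto simp: has_lifting_def)
qed

text \<open>
  The maps with the left lifting property against a fixed map are closed under all operations of a
  saturated class. For a monomorphism \<open>p\<close> lifts are moreover unique; this makes the lifts
  on the pieces of a coproduct or of a chain compatible without any choices along the way.
\<close>

lemma lifting_pushout: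
  assumes C: "is_category C" and p: "p \<in> hom C P Q"
    and i: "has_lifting C i p" and po: "is_pushout C i u j v"
  shows "has_lifting C j p"
proof -
  obtain A B X Y where h: "i \<in> hom C A B" "u \<in> hom C A X" "j \<in> hom C X Y" "v \<in> hom C B Y"
    and comm: "j \<cdot>\<^bsub>C\<^esub> u = v \<cdot>\<^bsub>C\<^esub> i"
    and univ: "\<And>Z a b. a \<in> hom C X Z \<Longrightarrow> b \<in> hom C B Z \<Longrightarrow> a \<cdot>\<^bsub>C\<^esub> u = b \<cdot>\<^bsub>C\<^esub> i \<Longrightarrow>
           (\<exists>!h. h \<in> hom C Y Z \<and> h \<cdot>\<^bsub>C\<^esub> j = a \<and> h \<cdot>\<^bsub>C\<^esub> v = b)"
    using po unfolding is_pushout_def by blast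
  show ?thesis
  proof (rule liftingI[OF h(3) p])
    fix a b assume a: "a \<in> hom C X P" and b: "b \<in> hom C Y Q" and ab: "p \<cdot>\<^bsub>C\<^esub> a = b \<cdot>\<^bsub>C\<^esub> j"
    have sq: "(p \<cdot>\<^bsub>C\<^esub> a) \<cdot>\<^bsub>C\<^esub> u = (b \<cdot>\<^bsub>C\<^esub> v) \<cdot>\<^bsub>C\<^esub> i"
      using ab comm hom_assoc[OF C h(2,3) b] hom_assoc[OF C h(1,4) b] by metis
    then have "p \<cdot>\<^bsub>C\<^esub> (a \<cdot>\<^bsub>C\<^esub> u) = (b \<cdot>\<^bsub>C\<^esub> v) \<cdot>\<^bsub>C\<^esub> i"
      using hom_assoc[OF C h(2) a p] by metis
    from liftingD[OF i h(1) p hom_comp[OF C h(2) a] hom_comp[OF C h(4) b] this]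
    obtain k where k: "k \<in> hom C B P" "k \<cdot>\<^bsub>C\<^esub> i = a \<cdot>\<^bsub>C\<^esub> u" "p \<cdot>\<^bsub>C\<^esub> k = b \<cdot>\<^bsub>C\<^esub> v" .
    from univ[OF a k(1)] k(2) obtain l where
      l: "l \<in> hom C Y P" "l \<cdot>\<^bsub>C\<^esub> j = a" "l \<cdot>\<^bsub>C\<^esub> v = k" by metis
    have "p \<cdot>\<^bsub>C\<^esub> l \<in> hom C Y Q" "(p \<cdot>\<^bsub>C\<^esub> l) \<cdot>\<^bsub>C\<^esub> j = p \<cdot>\<^bsub>C\<^esub> a" "(p \<cdot>\<^bsub>C\<^esub> l) \<cdot>\<^bsub>C\<^esub> v = b \<cdot>\<^bsub>C\<^esub> v"
      using hom_comp[OF C l(1) p] hom_assoc[OF C h(3) l(1) p] hom_assoc[OF C h(4) l(1) p] l k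
      by auto
    then have "p \<cdot>\<^bsub>C\<^esub> l = b"
      using univ[OF hom_comp[OF C a p] hom_comp[OF C h(4) b] sq] b ab by metis
    with l show "\<exists>h \<in> hom C Y P. h \<cdot>\<^bsub>C\<^esub> j = a \<and> p \<cdot>\<^bsub>C\<^esub> h = b" by blast
  qed
qed

lemma lifting_retract:
  assumes C: "is_category C" and p: "p \<in> hom C P Q"
    and g: "has_lifting C g p" and fg: "retract_of C f g"
  shows "has_lifting C f p"
proof -
  obtain A B X Y s r s' r' where h: "f \<in> hom C A B" "g \<in> hom C X Y"
      "s \<in> hom C A X" "r \<in> hom C X A" "s' \<in> hom C B Y" "r' \<in> hom C Y B"
    and e: "r \<cdot>\<^bsub>C\<^esub> s = Idn C A" "r' \<cdot>\<^bsub>C\<^esub> s' = Idn C B"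
      "g \<cdot>\<^bsub>C\<^esub> s = s' \<cdot>\<^bsub>C\<^esub> f" "f \<cdot>\<^bsub>C\<^esub> r = r' \<cdot>\<^bsub>C\<^esub> g"
    using fg unfolding retract_of_def by blast
  show ?thesis
  proof (rule liftingI[OF h(1) p])
    fix u v assume u: "u \<in> hom C A P" and v: "v \<in> hom C B Q" and uv: "p \<cdot>\<^bsub>C\<^esub> u = v \<cdot>\<^bsub>C\<^esub> f"
    have "p \<cdot>\<^bsub>C\<^esub> (u \<cdot>\<^bsub>C\<^esub> r) = (v \<cdot>\<^bsub>C\<^esub> r') \<cdot>\<^bsub>C\<^esub> g"
      using hom_assoc[OF C h(4) u p] hom_assoc[OF C h(4,1) v] hom_assoc[OF C h(2,6) v] uv e
      by metis
    from liftingD[OF g h(2) p hom_comp[OF C h(4) u] hom_comp[OF C h(6) v] this]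
    obtain k where k: "k \<in> hom C Y P" "k \<cdot>\<^bsub>C\<^esub> g = u \<cdot>\<^bsub>C\<^esub> r" "p \<cdot>\<^bsub>C\<^esub> k = v \<cdot>\<^bsub>C\<^esub> r'" .
    have "(k \<cdot>\<^bsub>C\<^esub> s') \<cdot>\<^bsub>C\<^esub> f = u"
      using hom_assoc[OF C h(1,5) k(1)] hom_assoc[OF C h(3,2) k(1)] hom_assoc[OF C h(3,4) u]
        e k hom_id[OF C u] by metis
    moreover have "p \<cdot>\<^bsub>C\<^esub> (k \<cdot>\<^bsub>C\<^esub> s') = v"
      using hom_assoc[OF C h(5) k(1) p] hom_assoc[OF C h(5,6) v] e k hom_id[OF C v] by metis
    ultimately show "\<exists>h \<in> hom C B P. h \<cdot>\<^bsub>C\<^esub> f = u \<and> p \<cdot>\<^bsub>C\<^esub> h = v"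
      using hom_comp[OF C h(5) k(1)] by blast
  qed
qed

lemma lifting_coproduct:
  assumes C: "is_category C" and p: "p \<in> hom C P Q" and m: "monomorphism C p"
    and g: "\<And>i. i \<in> I \<Longrightarrow> has_lifting C (g i) p" and f: "coproduct_arrow C I g f"
  shows "has_lifting C f p"
proof -
  obtain a b where fA: "f \<in> Ar C" and gA: "\<And>i. i \<in> I \<Longrightarrow> g i \<in> Ar C"
    and ca: "is_coproduct C I (\<lambda>i. Dom C (g i)) (Dom C f) a"
    and cb: "is_coproduct C I (\<lambda>i. Cod C (g i)) (Cod C f) b"
    and comm: "\<And>i. i \<in> I \<Longrightarrow> f \<cdot>\<^bsub>C\<^esub> a i = b i \<cdot>\<^bsub>C\<^esub> g i"
    using f unfolding coproduct_arrow_def by blast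
  have fh: "f \<in> hom C (Dom C f) (Cod C f)" using fA by (simp add: hom_def)
  have gh: "g i \<in> hom C (Dom C (g i)) (Cod C (g i))" if "i \<in> I" for i
    using gA[OF that] by (simp add: hom_def)
  have ah: "a i \<in> hom C (Dom C (g i)) (Dom C f)" and bh: "b i \<in> hom C (Cod C (g i)) (Cod C f)"
    if "i \<in> I" for i
    using ca cb that unfolding is_coproduct_def by blast+
  have univ: "\<exists>!h. h \<in> hom C (Cod C f) Z \<and> (\<forall>i\<in>I. h \<cdot>\<^bsub>C\<^esub> b i = q i)"
    if "Z \<in> Ob C" "\<And>i. i \<in> I \<Longrightarrow> q i \<in> hom C (Cod C (g i)) Z" for Z q
    using cb that unfolding is_coproduct_def by blast
  show ?thesis
  proof (rule liftingI[OF fh p])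
    fix u v assume u: "u \<in> hom C (Dom C f) P" and v: "v \<in> hom C (Cod C f) Q"
      and uv: "p \<cdot>\<^bsub>C\<^esub> u = v \<cdot>\<^bsub>C\<^esub> f"
    have "\<exists>k. k \<in> hom C (Cod C (g i)) P \<and> p \<cdot>\<^bsub>C\<^esub> k = v \<cdot>\<^bsub>C\<^esub> b i" if i: "i \<in> I" for i
    proof -
      have "p \<cdot>\<^bsub>C\<^esub> (u \<cdot>\<^bsub>C\<^esub> a i) = (v \<cdot>\<^bsub>C\<^esub> b i) \<cdot>\<^bsub>C\<^esub> g i"
        using hom_assoc[OF C ah[OF i] u p] hom_assoc[OF C ah[OF i] fh v]
          hom_assoc[OF C gh[OF i] bh[OF i] v] comm[OF i] uv by metis
      from liftingD[OF g[OF i] gh[OF i] p hom_comp[OF C ah[OF i] u] hom_comp[OF C bh[OF i] v] this]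
      show ?thesis by blast
    qed
    then obtain k where k: "\<And>i. i \<in> I \<Longrightarrow> k i \<in> hom C (Cod C (g i)) P"
      "\<And>i. i \<in> I \<Longrightarrow> p \<cdot>\<^bsub>C\<^esub> k i = v \<cdot>\<^bsub>C\<^esub> b i" by metis
    from univ[of P k] k(1) hom_Ob[OF C p] obtain h where
      h: "h \<in> hom C (Cod C f) P" "\<And>i. i \<in> I \<Longrightarrow> h \<cdot>\<^bsub>C\<^esub> b i = k i" by metis
    have 1: "(p \<cdot>\<^bsub>C\<^esub> h) \<cdot>\<^bsub>C\<^esub> b i = v \<cdot>\<^bsub>C\<^esub> b i" if "i \<in> I" for i
      using hom_assoc[OF C bh[OF that] h(1) p] h(2) k(2) that by metis
    have "\<exists>!h. h \<in> hom C (Cod C f) Q \<and> (\<forall>i\<in>I. h \<cdot>\<^bsub>C\<^esub> b i = v \<cdot>\<^bsub>C\<^esub> b i)"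
      using univ[of Q "\<lambda>i. v \<cdot>\<^bsub>C\<^esub> b i"] hom_comp[OF C bh v] hom_Ob[OF C p] by blast
    then have 2: "p \<cdot>\<^bsub>C\<^esub> h = v"
      using 1 v hom_comp[OF C h(1) p] by blast
    have "p \<cdot>\<^bsub>C\<^esub> (h \<cdot>\<^bsub>C\<^esub> f) = p \<cdot>\<^bsub>C\<^esub> u"
      using hom_assoc[OF C fh h(1) p] 2 uv by metis
    from mono_cancel[OF m p hom_comp[OF C fh h(1)] u this] h 2
    show "\<exists>h \<in> hom C (Cod C f) P. h \<cdot>\<^bsub>C\<^esub> f = u \<and> p \<cdot>\<^bsub>C\<^esub> h = v" by blast
  qed
qed

text \<open>
  The lifts are found by well-founded induction along the chain: for a successor by the lifting
  property of the step, at a limit by gluing the earlier lifts, and the same gluing over the whole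
  chain yields the lift out of the colimit.
\<close>

lemma lifting_transfinite_composite:
  assumes C: "is_category C" and p: "p \<in> hom C P Q" and m: "monomorphism C p"
    and tc: "transfinite_composite C S r X D f"
    and S: "\<And>i. i \<in> S \<Longrightarrow> has_lifting C i p"
  shows "f \<in> Ar C \<and> has_lifting C f p"
proof -
  from tc have wo: "Well_order r" and ch: "is_chain C r X D"
    and suc: "\<And>a b. successor_of r a b \<Longrightarrow> D a b \<in> S"
    and lim: "\<And>b. limit_elem r b \<Longrightarrow> chain_colimit C r X D (below r b) (X b) (\<lambda>a. D a b)"
    unfolding transfinite_composite_def by auto
  from tc obtain T t z where T: "chain_colimit C r X D (Field r) T t"
    and z: "z \<in> Field r" "below r z = {}" and ft: "f = t z"
    unfolding transfinite_composite_def by blast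
  have th: "t a \<in> hom C (X a) T" if "a \<in> Field r" for a
    using T that unfolding chain_colimit_def chain_cocone_def by blast
  have tD: "t b \<cdot>\<^bsub>C\<^esub> D a b = t a" if "(a, b) \<in> r" for a b
    using T that unfolding chain_colimit_def chain_cocone_def by (blast intro: FieldI1 FieldI2)
  have Dh: "D a b \<in> hom C (X a) (X b)" if "(a, b) \<in> r" for a b
    using ch that unfolding is_chain_def by blast
  have DD: "D b c \<cdot>\<^bsub>C\<^esub> D a b = D a c" if "(a, b) \<in> r" "(b, c) \<in> r" for a b c
    using ch that unfolding is_chain_def by blast
  have XOb: "X a \<in> Ob C" if "a \<in> Field r" for a
    using ch that unfolding is_chain_def by blast
  have POb: "P \<in> Ob C" "Q \<in> Ob C" using hom_Ob[OF C p] by auto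
  \<comment> \<open>if a map out of the colimit of a part of the chain lifts along \<open>p\<close> on each stage, then it lifts;
     uniqueness of lifts makes the chosen ones a cocone\<close>
  have glue: "\<exists>h. h \<in> hom C L P \<and> p \<cdot>\<^bsub>C\<^esub> h = w"
    if L: "chain_colimit C r X D I L l" and w: "w \<in> hom C L Q" and I: "I \<subseteq> Field r"
      and ex: "\<And>a. a \<in> I \<Longrightarrow> \<exists>h. h \<in> hom C (X a) P \<and> p \<cdot>\<^bsub>C\<^esub> h = w \<cdot>\<^bsub>C\<^esub> l a" for I L l w
  proof -
    have lh: "l a \<in> hom C (X a) L" if "a \<in> I" for a
      using L that unfolding chain_colimit_def chain_cocone_def by blast
    have lD: "l b \<cdot>\<^bsub>C\<^esub> D a b = l a" if "(a, b) \<in> r" "a \<in> I" "b \<in> I" for a b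
      using L that unfolding chain_colimit_def chain_cocone_def by blast
    obtain k where k: "\<And>a. a \<in> I \<Longrightarrow> k a \<in> hom C (X a) P"
      "\<And>a. a \<in> I \<Longrightarrow> p \<cdot>\<^bsub>C\<^esub> k a = w \<cdot>\<^bsub>C\<^esub> l a" using ex by metis
    have kD: "k b \<cdot>\<^bsub>C\<^esub> D a b = k a" if ab: "(a, b) \<in> r" "a \<in> I" "b \<in> I" for a b
    proof (rule mono_cancel[OF m p hom_comp[OF C Dh[OF ab(1)] k(1)[OF ab(3)]] k(1)[OF ab(2)]])
      show "p \<cdot>\<^bsub>C\<^esub> (k b \<cdot>\<^bsub>C\<^esub> D a b) = p \<cdot>\<^bsub>C\<^esub> k a"
        using hom_assoc[OF C Dh[OF ab(1)] k(1)[OF ab(3)] p]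
          hom_assoc[OF C Dh[OF ab(1)] lh[OF ab(3)] w] k(2) lD[OF ab] ab by metis
    qed
    have "chain_cocone C r X D I P k"
      unfolding chain_cocone_def using k(1) kD POb by blast
    with L obtain h where h: "h \<in> hom C L P" "\<And>a. a \<in> I \<Longrightarrow> h \<cdot>\<^bsub>C\<^esub> l a = k a"
      unfolding chain_colimit_def by metis
    have "chain_cocone C r X D I Q (\<lambda>a. w \<cdot>\<^bsub>C\<^esub> l a)"
      unfolding chain_cocone_def
    proof (intro conjI ballI impI)
      fix a b assume ab: "a \<in> I" "b \<in> I" "(a, b) \<in> r"
      show "(w \<cdot>\<^bsub>C\<^esub> l b) \<cdot>\<^bsub>C\<^esub> D a b = w \<cdot>\<^bsub>C\<^esub> l a"
        using hom_assoc[OF C Dh[OF ab(3)] lh[OF ab(2)] w] lD[OF ab(3,1,2)] by metis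
    qed (use hom_comp[OF C lh w] POb in auto)
    then have "\<exists>!h. h \<in> hom C L Q \<and> (\<forall>a\<in>I. h \<cdot>\<^bsub>C\<^esub> l a = w \<cdot>\<^bsub>C\<^esub> l a)"
      using L[unfolded chain_colimit_def, THEN conjunct2, rule_format] by blast
    moreover have "(p \<cdot>\<^bsub>C\<^esub> h) \<cdot>\<^bsub>C\<^esub> l a = w \<cdot>\<^bsub>C\<^esub> l a" if "a \<in> I" for a
      using hom_assoc[OF C lh[OF that] h(1) p] h(2)[OF that] k(2)[OF that] by metis
    ultimately have "p \<cdot>\<^bsub>C\<^esub> h = w" using w hom_comp[OF C h(1) p] by blast
    with h(1) show ?thesis by blast
  qed
  have "has_lifting C (t z) p"
  proof (rule liftingI[OF th[OF z(1)] p])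
    fix u v assume u: "u \<in> hom C (X z) P" and v: "v \<in> hom C T Q" and uv: "p \<cdot>\<^bsub>C\<^esub> u = v \<cdot>\<^bsub>C\<^esub> t z"
    have wf: "wf (r - Id)" using wo by (simp add: well_order_on_def)
    have ex: "a \<in> Field r \<Longrightarrow> \<exists>h. h \<in> hom C (X a) P \<and> p \<cdot>\<^bsub>C\<^esub> h = v \<cdot>\<^bsub>C\<^esub> t a" for a
    proof (induction a rule: wf_induct_rule[OF wf])
      case (1 b)
      have below: "\<exists>h. h \<in> hom C (X a) P \<and> p \<cdot>\<^bsub>C\<^esub> h = v \<cdot>\<^bsub>C\<^esub> t a" if "a \<in> below r b" for a
        using that 1(1)[of a] by (auto simp: below_def intro: FieldI1)
      consider "below r b = {}" | a where "successor_of r a b" | "limit_elem r b"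
        using 1 unfolding limit_elem_def by blast
      then show ?case
      proof cases
        case 1
        have "z = b"
        proof (rule ccontr)
          assume "z \<noteq> b"
          then have "(z, b) \<in> r \<or> (b, z) \<in> r"
            using wo z(1) \<open>b \<in> Field r\<close>
            by (auto simp: well_order_on_def linear_order_on_def total_on_def)
          with \<open>z \<noteq> b\<close> 1 z show False by (auto simp: below_def)
        qed
        with u uv show ?thesis by blast
      next
        case (2 a)
        then have ab: "(a, b) \<in> r" "a \<in> below r b" by (auto simp: successor_of_def below_def)
        from below[OF ab(2)] obtain k where
          k: "k \<in> hom C (X a) P" "p \<cdot>\<^bsub>C\<^esub> k = v \<cdot>\<^bsub>C\<^esub> t a" by blast
        have "p \<cdot>\<^bsub>C\<^esub> k = (v \<cdot>\<^bsub>C\<^esub> t b) \<cdot>\<^bsub>C\<^esub> D a b"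
          using k(2) tD[OF ab(1)] hom_assoc[OF C Dh[OF ab(1)] th[OF \<open>b \<in> Field r\<close>] v] by metis
        from liftingD[OF S[OF suc[OF 2]] Dh[OF ab(1)] p k(1) hom_comp[OF C th[OF \<open>b \<in> Field r\<close>] v] this]
        show ?thesis by blast
      next
        case 3
        have b: "b \<in> Field r" by fact
        show ?thesis
        proof (rule glue[OF lim[OF 3] hom_comp[OF C th[OF b] v]])
          show "below r b \<subseteq> Field r" by (auto simp: below_def intro: FieldI1)
          fix a assume a: "a \<in> below r b"
          then have "(a, b) \<in> r" by (simp add: below_def)
          then have "(v \<cdot>\<^bsub>C\<^esub> t b) \<cdot>\<^bsub>C\<^esub> D a b = v \<cdot>\<^bsub>C\<^esub> t a"
            using hom_assoc[OF C Dh th[OF b] v] tD by metis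
          with below[OF a] show "\<exists>h. h \<in> hom C (X a) P \<and> p \<cdot>\<^bsub>C\<^esub> h = (v \<cdot>\<^bsub>C\<^esub> t b) \<cdot>\<^bsub>C\<^esub> D a b"
            by simp
        qed
      qed
    qed
    from glue[OF T v subset_refl ex] obtain h where
      h: "h \<in> hom C T P" "p \<cdot>\<^bsub>C\<^esub> h = v" by blast
    have "p \<cdot>\<^bsub>C\<^esub> (h \<cdot>\<^bsub>C\<^esub> t z) = p \<cdot>\<^bsub>C\<^esub> u"
      using hom_assoc[OF C th[OF z(1)] h(1) p] h uv by metis
    from mono_cancel[OF m p hom_comp[OF C th[OF z(1)] h(1)] u this] h
    show "\<exists>h \<in> hom C T P. h \<cdot>\<^bsub>C\<^esub> t z = u \<and> p \<cdot>\<^bsub>C\<^esub> h = v" by blast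
  qed
  with ft th[OF z(1)] show ?thesis by (auto dest: hom_Ar)
qed

text \<open>
  Used in the contrapositive form: a map that fails to lift against a monomorphism against which
  all generators lift is not in the saturated hull of these generators.
\<close>

lemma saturated_lifting_mono:
  assumes C: "is_category C" and m: "monomorphism C p"
  shows "saturated C {i \<in> Ar C. has_lifting C i p}"
proof -
  have p: "p \<in> hom C (Dom C p) (Cod C p)" using m by (simp add: monomorphism_def hom_def)
  show ?thesis
    unfolding saturated_def
  proof (intro conjI allI impI)
    fix i u j v assume "i \<in> {i \<in> Ar C. has_lifting C i p}" "is_pushout C i u j v"
    then show "j \<in> {i \<in> Ar C. has_lifting C i p}"
      using lifting_pushout[OF C p, of i u j v] by (auto simp: is_pushout_def dest: hom_Ar)
  next
    fix I g f assume "\<forall>i\<in>I. g i \<in> {i \<in> Ar C. has_lifting C i p}" "coproduct_arrow C I g f"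
    then show "f \<in> {i \<in> Ar C. has_lifting C i p}"
      using lifting_coproduct[OF C p m, of I g f] by (auto simp: coproduct_arrow_def)
  next
    fix r X D f assume "transfinite_composite C {i \<in> Ar C. has_lifting C i p} r X D f"
    then show "f \<in> {i \<in> Ar C. has_lifting C i p}"
      using lifting_transfinite_composite[OF C p m, of _ r X D f] by blast
  next
    fix f g assume "g \<in> {i \<in> Ar C. has_lifting C i p}" "retract_of C f g"
    then show "f \<in> {i \<in> Ar C. has_lifting C i p}"
      using lifting_retract[OF C p, of g f] by (auto simp: retract_of_def dest: hom_Ar)
  qed auto
qed

section \<open>Weak equivalences in a model category\<close>

lemma retract_ofI:
  assumes "f \<in> hom C A B" "g \<in> hom C X Y" "s \<in> hom C A X" "r \<in> hom C X A"
    "s' \<in> hom C B Y" "r' \<in> hom C Y B" "r \<cdot>\<^bsub>C\<^esub> s = Idn C A" "r' \<cdot>\<^bsub>C\<^esub> s' = Idn C B"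
    "g \<cdot>\<^bsub>C\<^esub> s = s' \<cdot>\<^bsub>C\<^esub> f" "f \<cdot>\<^bsub>C\<^esub> r = r' \<cdot>\<^bsub>C\<^esub> g"
  shows "retract_of C f g"
  using assms unfolding retract_of_def by blast

text \<open>
  The retract argument: factoring \<open>p = q \<circ> i\<close> into a cofibration and a trivial fibration, a lift in
  the square with sides \<open>i\<close> and \<open>p\<close> exhibits \<open>p\<close> as a retract of \<open>q\<close>.
\<close>

lemma trivial_fibrationI:
  assumes C: "is_category C" and M: "model_structure C W K F" and p: "p \<in> hom C X Y"
    and lift: "\<And>i. i \<in> K \<Longrightarrow> has_lifting C i p"
  shows "p \<in> W"
proof -
  have "has_factorization C K (F \<inter> W)" using M by (simp add: model_structure_def)
  with p obtain Z i q where i: "i \<in> K" "i \<in> hom C X Z" and q: "q \<in> W" "q \<in> hom C Z Y"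
    and pq: "p = q \<cdot>\<^bsub>C\<^esub> i"
    unfolding has_factorization_def hom_def by fastforce
  have X: "Idn C X \<in> hom C X X" and Y: "Idn C Y \<in> hom C Y Y"
    using hom_Ob[OF C p] id_hom[OF C] by auto
  have "p \<cdot>\<^bsub>C\<^esub> Idn C X = q \<cdot>\<^bsub>C\<^esub> i" using hom_id[OF C p] pq by simp
  from liftingD[OF lift[OF i(1)] i(2) p X q(2) this] obtain h where
    h: "h \<in> hom C Z X" "h \<cdot>\<^bsub>C\<^esub> i = Idn C X" "p \<cdot>\<^bsub>C\<^esub> h = q" .
  have "retract_of C p q"
  proof (rule retract_ofI[OF p q(2) i(2) h(1) Y Y h(2)])
    show "Idn C Y \<cdot>\<^bsub>C\<^esub> Idn C Y = Idn C Y" by (rule hom_id[OF C Y])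
    show "q \<cdot>\<^bsub>C\<^esub> i = Idn C Y \<cdot>\<^bsub>C\<^esub> p" using pq hom_id(2)[OF C p] by simp
    show "p \<cdot>\<^bsub>C\<^esub> h = Idn C Y \<cdot>\<^bsub>C\<^esub> q" using h(3) hom_id(2)[OF C q(2)] by simp
  qed
  moreover have "\<forall>f g. g \<in> W \<longrightarrow> retract_of C f g \<longrightarrow> f \<in> W"
    using M unfolding model_structure_def by blast
  ultimately show ?thesis using q(1) by blast
qed

lemma fibrant_replacement:
  assumes C: "is_category C" and M: "model_structure C W K F" and T: "terminal C T" and X: "X \<in> Ob C"
  obtains k Y where "k \<in> hom C X Y" "k \<in> W" "fibrant C F Y"
proof -
  obtain t where t: "t \<in> hom C X T" using T X unfolding terminal_def by blast
  have "has_factorization C (K \<inter> W) F" using M by (simp add: model_structure_def)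
  with t obtain Y k p where k: "k \<in> W" "k \<in> hom C X Y" and p: "p \<in> F" "p \<in> hom C Y T"
    unfolding has_factorization_def hom_def by fastforce
  then have "fibrant C F Y"
    using T hom_Ob[OF C p(2)] unfolding fibrant_def by blast
  with k that show ?thesis by blast
qed

lemma weq_two_of_three:
  assumes M: "model_structure C W K F" and f: "f \<in> hom C X Y" and g: "g \<in> hom C Y Z"
  shows weq_comp: "f \<in> W \<Longrightarrow> g \<in> W \<Longrightarrow> g \<cdot>\<^bsub>C\<^esub> f \<in> W"
    and weq_cancel_right: "f \<in> W \<Longrightarrow> g \<cdot>\<^bsub>C\<^esub> f \<in> W \<Longrightarrow> g \<in> W"
    and weq_cancel_left: "g \<in> W \<Longrightarrow> g \<cdot>\<^bsub>C\<^esub> f \<in> W \<Longrightarrow> f \<in> W"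
proof -
  have "two_out_of_three C W" using M by (simp add: model_structure_def)
  then show "f \<in> W \<Longrightarrow> g \<in> W \<Longrightarrow> g \<cdot>\<^bsub>C\<^esub> f \<in> W" "f \<in> W \<Longrightarrow> g \<cdot>\<^bsub>C\<^esub> f \<in> W \<Longrightarrow> g \<in> W"
    "g \<in> W \<Longrightarrow> g \<cdot>\<^bsub>C\<^esub> f \<in> W \<Longrightarrow> f \<in> W"
    using f g unfolding two_out_of_three_def by blast+
qed

text \<open>
  A split monomorphism \<open>g\<close> with retraction \<open>r\<close> is a retract of the idempotent \<open>g \<circ> r\<close>. This takes
  the place of the two-out-of-six property, which is not among the axioms.
\<close>

lemma weq_split_mono:
  assumes C: "is_category C" and M: "model_structure C W K F"
    and g: "g \<in> hom C P X" and r: "r \<in> hom C X P" and rg: "r \<cdot>\<^bsub>C\<^esub> g = Idn C P"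
    and W: "g \<cdot>\<^bsub>C\<^esub> r \<in> W"
  shows "g \<in> W"
proof -
  have X: "Idn C X \<in> hom C X X" using hom_Ob[OF C g] id_hom[OF C] by auto
  have "(g \<cdot>\<^bsub>C\<^esub> r) \<cdot>\<^bsub>C\<^esub> g = g"
    using hom_assoc[OF C g r g] rg hom_id[OF C g] by simp
  note grg = this
  have "retract_of C g (g \<cdot>\<^bsub>C\<^esub> r)"
  proof (rule retract_ofI[OF g hom_comp[OF C r g] g r X X rg])
    show "Idn C X \<cdot>\<^bsub>C\<^esub> Idn C X = Idn C X" by (rule hom_id[OF C X])
    show "(g \<cdot>\<^bsub>C\<^esub> r) \<cdot>\<^bsub>C\<^esub> g = Idn C X \<cdot>\<^bsub>C\<^esub> g" using grg hom_id(2)[OF C g] by simp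
    show "g \<cdot>\<^bsub>C\<^esub> r = Idn C X \<cdot>\<^bsub>C\<^esub> (g \<cdot>\<^bsub>C\<^esub> r)"
      using hom_id(2)[OF C hom_comp[OF C r g]] by simp
  qed
  moreover have "\<forall>f g. g \<in> W \<longrightarrow> retract_of C f g \<longrightarrow> f \<in> W"
    using M unfolding model_structure_def by blast
  ultimately show ?thesis using W by blast
qed

section \<open>Simplicial sets of words and their inner horn fillings\<close>

text \<open>
  A simplicial subset of the nerve of a preorder on the natural numbers is a set of nonempty lists
  (the list of vertices of a simplex) closed under precomposition with monotone maps.
\<close>

definition word_closed :: "nat list set \<Rightarrow> bool" where
  "word_closed S \<longleftrightarrow>
     (\<forall>x \<in> S. x \<noteq> [] \<and> (\<forall>m. \<forall>\<theta> \<in> ord_maps m (length x - 1). map (nth x) \<theta> \<in> S))"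

text \<open>
  A map of simplicial sets out of such a set of words, as one function on words; the dimension of a
  word is its length minus one.
\<close>

definition word_map :: "nat list set \<Rightarrow> 'a sset \<Rightarrow> (nat list \<Rightarrow> 'a) \<Rightarrow> bool" where
  "word_map S Y G \<longleftrightarrow>
     (\<forall>x \<in> S. G x \<in> simplices Y (length x - 1) \<and>
        (\<forall>m. \<forall>\<theta> \<in> ord_maps m (length x - 1).
           G (map (nth x) \<theta>) = act Y (length x - 1) \<theta> (G x)))"

definition simplex_words :: "nat \<Rightarrow> nat list set" where
  "simplex_words n = {x. x \<noteq> [] \<and> sorted x \<and> set x \<subseteq> {0..n}}"

definition horn_words :: "nat \<Rightarrow> nat \<Rightarrow> nat list set" where
  "horn_words n k = {x \<in> simplex_words n. \<exists>j \<in> {0..n}. j \<noteq> k \<and> j \<notin> set x}"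

text \<open>
  The simplex \<open>\<dots>, c, 1 - c, c, 2\<close> of dimension \<open>n\<close> in the nerve of the category that consists of
  the isomorphic objects \<open>0 \<cong> 1\<close> and a terminal object \<open>2\<close>. It alternates between \<open>0\<close> and \<open>1\<close> and
  reaches \<open>c\<close> just before the final \<open>2\<close>.
\<close>

definition alternating :: "nat \<Rightarrow> nat \<Rightarrow> nat \<Rightarrow> nat" where
  "alternating c n i = (if n \<le> i then 2 else if odd (n - i) then c else 1 - c)"

text \<open>
  The groupoid on \<open>0 \<cong> 1\<close> together with the alternating simplex of dimension \<open>n\<close>. For
  \<open>n > 0\<close>, passing from \<open>n\<close> to \<open>n + 1\<close> adds exactly two nondegenerate simplices: the new alternating simplex, and its
  face opposite to the vertex \<open>n\<close>, the last one before \<open>2\<close>. Hence it fills one inner horn.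
\<close>

definition stage :: "nat \<Rightarrow> nat \<Rightarrow> nat list set" where
  "stage c n = {w. w \<noteq> [] \<and> set w \<subseteq> {0, 1}} \<union> map (alternating c n) ` simplex_words n"

lemma word_closedD:
  "word_closed S \<Longrightarrow> x \<in> S \<Longrightarrow> \<theta> \<in> ord_maps m (length x - 1) \<Longrightarrow> map (nth x) \<theta> \<in> S"
  by (auto simp: word_closed_def)

lemma ord_maps_nth_less:
  "\<theta> \<in> ord_maps m (length x - 1) \<Longrightarrow> x \<noteq> [] \<Longrightarrow> i \<in> set \<theta> \<Longrightarrow> i < length x"
  by (cases x) (auto simp: ord_maps_def less_Suc_eq_le)

lemma set_subword:
  "\<theta> \<in> ord_maps m (length x - 1) \<Longrightarrow> x \<noteq> [] \<Longrightarrow> set (map (nth x) \<theta>) \<subseteq> set x"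
  using ord_maps_nth_less[of \<theta> m x] by auto

lemma sorted_wrt_subword:
  assumes th: "\<theta> \<in> ord_maps m (length x - 1)" and "x \<noteq> []" and x: "sorted_wrt R x"
    and refl: "\<And>a. R a a"
  shows "sorted_wrt R (map (nth x) \<theta>)"
  unfolding sorted_wrt_iff_nth_less
proof (intro allI impI)
  fix i j assume ij: "i < j" "j < length (map (nth x) \<theta>)"
  then have "\<theta> ! i \<le> \<theta> ! j"
    using th by (simp add: ord_maps_def sorted_nth_mono)
  moreover have "\<theta> ! j < length x"
    using ij ord_maps_nth_less[OF th \<open>x \<noteq> []\<close>, of "\<theta> ! j"] by simp
  ultimately have "R (x ! (\<theta> ! i)) (x ! (\<theta> ! j))"
    using x refl by (cases "\<theta> ! i = \<theta> ! j") (auto simp: sorted_wrt_iff_nth_less)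
  then show "R (map (nth x) \<theta> ! i) (map (nth x) \<theta> ! j)" using ij by simp
qed

lemma subword_nonempty: "\<theta> \<in> ord_maps m n \<Longrightarrow> map (nth x) \<theta> \<noteq> []"
  by (auto simp: ord_maps_def)

lemma map_subword:
  assumes "\<theta> \<in> ord_maps m (length x - 1)" "x \<noteq> []"
  shows "map f (map (nth x) \<theta>) = map (nth (map f x)) \<theta>"
  using ord_maps_nth_less[OF assms] by simp

lemma word_closed_letters: "word_closed {w. w \<noteq> [] \<and> set w \<subseteq> L}"
  unfolding word_closed_def
proof (intro ballI conjI allI)
  fix x m \<theta> assume "x \<in> {w. w \<noteq> [] \<and> set w \<subseteq> L}" and th: "\<theta> \<in> ord_maps m (length x - 1)"
  then have x: "x \<noteq> []" "set x \<subseteq> L" by auto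
  show "map (nth x) \<theta> \<in> {w. w \<noteq> [] \<and> set w \<subseteq> L}"
    using subset_trans[OF set_subword[OF th x(1)] x(2)] subword_nonempty[OF th] by simp
qed simp

lemma word_closed_Un: "word_closed S \<Longrightarrow> word_closed T \<Longrightarrow> word_closed (S \<union> T)"
  by (auto simp: word_closed_def)

lemma word_closed_image:
  assumes "word_closed S"
  shows "word_closed (map f ` S)"
  unfolding word_closed_def
proof (intro ballI conjI allI)
  fix y assume "y \<in> map f ` S"
  then obtain x where x: "x \<in> S" "y = map f x" by blast
  with assms have ne: "x \<noteq> []" by (auto simp: word_closed_def)
  with x show "y \<noteq> []" by simp
  fix m \<theta> assume "\<theta> \<in> ord_maps m (length y - 1)"
  with x have "\<theta> \<in> ord_maps m (length x - 1)" by simp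
  with map_subword[OF this ne, of f] word_closedD[OF assms x(1) this] x(2)
  show "map (nth y) \<theta> \<in> map f ` S" by (metis image_eqI)
qed

lemma word_closed_sorted: "word_closed {w. w \<noteq> [] \<and> sorted w \<and> set w \<subseteq> L}"
  unfolding word_closed_def
proof (intro ballI conjI allI)
  fix x m \<theta> assume x: "x \<in> {w. w \<noteq> [] \<and> sorted w \<and> set w \<subseteq> L}"
    and th: "\<theta> \<in> ord_maps m (length x - 1)"
  from x have ne: "x \<noteq> []" and s: "sorted x" and L: "set x \<subseteq> L" by auto
  show "map (nth x) \<theta> \<in> {w. w \<noteq> [] \<and> sorted w \<and> set w \<subseteq> L}"
    using subset_trans[OF set_subword[OF th ne] L] subword_nonempty[OF th]
      sorted_wrt_subword[OF th ne s] by simp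
qed simp

lemma word_closed_simplex: "word_closed (simplex_words n)"
  unfolding simplex_words_def by (rule word_closed_sorted)

lemma word_closed_horn: "word_closed (horn_words n k)"
  unfolding word_closed_def
proof (intro ballI conjI allI)
  fix x assume x: "x \<in> horn_words n k"
  then show ne: "x \<noteq> []" by (simp add: horn_words_def simplex_words_def)
  fix m \<theta> assume "\<theta> \<in> ord_maps m (length x - 1)"
  then show "map (nth x) \<theta> \<in> horn_words n k"
    using x set_subword[OF _ ne] word_closedD[OF word_closed_simplex]
    unfolding horn_words_def by blast
qed

lemma word_closed_stage: "word_closed (stage c n)"
  unfolding stage_def
  by (intro word_closed_Un word_closed_letters word_closed_image word_closed_simplex)

lemma word_map_comp:
  assumes G: "word_map T Y G" and S: "word_closed S" and f: "\<And>x. x \<in> S \<Longrightarrow> map f x \<in> T"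
  shows "word_map S Y (\<lambda>x. G (map f x))"
  unfolding word_map_def
proof (intro ballI conjI allI)
  fix x assume x: "x \<in> S"
  then have ne: "x \<noteq> []" using S by (simp add: word_closed_def)
  show "G (map f x) \<in> simplices Y (length x - 1)"
    using G f[OF x] by (auto simp: word_map_def)
  fix m \<theta> assume th: "\<theta> \<in> ord_maps m (length x - 1)"
  then show "G (map f (map (nth x) \<theta>)) = act Y (length x - 1) \<theta> (G (map f x))"
    using G f[OF x] unfolding map_subword[OF th ne] word_map_def by fastforce
qed

lemma simplices_horn: "simplices (horn n k) m = {x \<in> horn_words n k. length x = Suc m}"
  by (auto simp: horn_def horn_words_def simplex_words_def ord_maps_def)

lemma simplices_std_simplex:
  "simplices (std_simplex n) m = {x \<in> simplex_words n. length x = Suc m}"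
  by (auto simp: std_simplex_def simplex_words_def ord_maps_def)

lemma quasi_category_fills_horn_words:
  assumes Y: "quasi_category Y" and k: "0 < k" "k < n" and G: "word_map (horn_words n k) Y G"
  obtains F where "word_map (simplex_words n) Y F" "\<And>x. x \<in> horn_words n k \<Longrightarrow> F x = G x"
proof -
  have "sset_map (horn n k) Y (\<lambda>m. restrict G (simplices (horn n k) m))"
    unfolding sset_map_def
  proof (intro conjI allI ballI)
    fix m show "restrict G (simplices (horn n k) m) \<in> simplices (horn n k) m \<rightarrow>\<^sub>E simplices Y m"
      using G by (auto simp: simplices_horn word_map_def)
  next
    fix m l \<theta> x assume th: "\<theta> \<in> ord_maps m l" and x: "x \<in> simplices (horn n k) l"
    then have l: "l = length x - 1" and xh: "x \<in> horn_words n k"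
      by (auto simp: simplices_horn)
    have e: "act (horn n k) l \<theta> x = map (nth x) \<theta>" by (simp add: horn_def)
    have "map (nth x) \<theta> \<in> simplices (horn n k) m"
      using word_closedD[OF word_closed_horn xh, of \<theta> m] th l
      by (auto simp: simplices_horn ord_maps_def)
    with th x xh l G show "restrict G (simplices (horn n k) m) (act (horn n k) l \<theta> x) =
        act Y l \<theta> (restrict G (simplices (horn n k) l) x)"
      unfolding e by (simp add: word_map_def)
  qed
  note horn_map = this
  from Y have "sset_map (horn n k) Y f \<longrightarrow> (\<exists>g. sset_map (std_simplex n) Y g \<and>
      (\<forall>m. \<forall>x \<in> simplices (horn n k) m. g m x = f m x))" for f
    using k unfolding quasi_category_def by simp
  from this[THEN mp, OF horn_map] obtain g where g: "sset_map (std_simplex n) Y g"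
    "\<And>m x. x \<in> simplices (horn n k) m \<Longrightarrow> g m x = restrict G (simplices (horn n k) m) x"
    by blast
  have lev: "x \<in> simplices (std_simplex n) (length x - 1)" if "x \<in> simplex_words n" for x
    using that by (auto simp: simplices_std_simplex simplex_words_def)
  show ?thesis
  proof (rule that[of "\<lambda>x. g (length x - 1) x"])
    show "word_map (simplex_words n) Y (\<lambda>x. g (length x - 1) x)"
      unfolding word_map_def
    proof (intro conjI allI ballI)
      fix x assume x: "x \<in> simplex_words n"
      show "g (length x - 1) x \<in> simplices Y (length x - 1)"
        using g(1) lev[OF x] by (auto simp: sset_map_def)
      fix m \<theta> assume th: "\<theta> \<in> ord_maps m (length x - 1)"
      then have "length (map (nth x) \<theta>) - 1 = m" by (simp add: ord_maps_def)
      moreover have "g m (act (std_simplex n) (length x - 1) \<theta> x) =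
          act Y (length x - 1) \<theta> (g (length x - 1) x)"
        using g(1) lev[OF x] th by (simp add: sset_map_def)
      ultimately show "g (length (map (nth x) \<theta>) - 1) (map (nth x) \<theta>) =
          act Y (length x - 1) \<theta> (g (length x - 1) x)"
        by (simp add: std_simplex_def)
    qed
    fix x assume "x \<in> horn_words n k"
    then have "x \<in> simplices (horn n k) (length x - 1)"
      by (auto simp: simplices_horn horn_words_def simplex_words_def)
    then show "g (length x - 1) x = G x" using g(2) by simp
  qed
qed

lemma alternating_Suc: "alternating c (Suc n) (Suc i) = alternating c n i"
  by (simp add: alternating_def)

lemma alternating_letter: "c \<le> 1 \<Longrightarrow> i < n \<Longrightarrow> alternating c n i \<in> {0, 1}"
  by (auto simp: alternating_def)

lemma alternating_neq_Suc:
  assumes "c \<le> 1" "i < n"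
  shows "alternating c n i \<noteq> alternating c n (Suc i)"
proof -
  have "c \<noteq> 1 - c" "c \<noteq> 2" "1 - c \<noteq> 2" using assms(1) by arith+
  with assms(2) show ?thesis by (auto simp: alternating_def)
qed

lemma stage_Suc: "stage c n \<subseteq> stage c (Suc n)"
proof -
  have "map (alternating c n) y \<in> map (alternating c (Suc n)) ` simplex_words (Suc n)"
    if "y \<in> simplex_words n" for y
  proof
    show "map (alternating c n) y = map (alternating c (Suc n)) (map Suc y)"
      by (simp add: alternating_Suc comp_def)
    show "map Suc y \<in> simplex_words (Suc n)"
      using that by (auto simp: simplex_words_def sorted_map)
  qed
  then show ?thesis by (auto simp: stage_def)
qed

text \<open>
  Omitting the final vertex \<open>2\<close> of the alternating simplex leaves a simplex of the groupoid;
  omitting the first vertex leaves the previous alternating simplex; omitting a vertex \<open>j\<close> in between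
  leaves two equal neighbours, so that the face is degenerate.
\<close>

lemma stage_horn:
  assumes c: "c \<le> 1" and y: "y \<in> horn_words (Suc n) n"
  shows "map (alternating c (Suc n)) y \<in> stage c n"
proof -
  from y obtain j where j: "j \<le> Suc n" "j \<noteq> n" "j \<notin> set y" and ys: "y \<in> simplex_words (Suc n)"
    by (auto simp: horn_words_def)
  show ?thesis
  proof (cases "j = Suc n")
    case True
    have "alternating c (Suc n) i \<in> {0, 1}" if "i \<in> set y" for i
    proof (rule alternating_letter[OF c])
      have "i \<le> Suc n" "i \<noteq> Suc n" using ys j True that by (auto simp: simplex_words_def)
      then show "i < Suc n" by simp
    qed
    then have "set (map (alternating c (Suc n)) y) \<subseteq> {0, 1}"
      unfolding set_map by (rule image_subsetI)
    with ys show ?thesis by (auto simp: stage_def simplex_words_def)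
  next
    case False
    with j have jn: "j < n" by simp
    \<comment> \<open>letters two apart agree: shifting the part before \<open>j\<close> up by two and then everything
       down by one yields a position in the previous alternating simplex\<close>
    let ?s = "\<lambda>i. if i < j then Suc i else i - 1"
    have "map (alternating c (Suc n)) y = map (alternating c n) (map ?s y)"
      using jn j(3) by (auto simp: alternating_def)
    moreover have "map ?s y \<in> simplex_words n"
    proof -
      have "sorted (map ?s y)"
        unfolding sorted_iff_nth_mono
      proof (intro allI impI)
        fix a b assume ab: "a \<le> b" "b < length (map ?s y)"
        then have "y ! a \<le> y ! b" using ys by (auto simp: simplex_words_def sorted_nth_mono)
        moreover have "y ! a \<noteq> j" "y ! b \<noteq> j" using ab j(3) by (auto simp: in_set_conv_nth)
        ultimately show "map ?s y ! a \<le> map ?s y ! b" using ab by auto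
      qed
      with ys jn show ?thesis by (fastforce simp: simplex_words_def)
    qed
    ultimately show ?thesis unfolding stage_def by (intro UnI2) (rule image_eqI)
  qed
qed

text \<open>
  Each change of letter forces a position to advance. Reading words from the end, where the letter
  \<open>2\<close> is only found at position \<open>n + 1\<close>, a factorization \<open>y\<close> that skips no position except perhaps
  \<open>n\<close> is therefore the pointwise largest one.
\<close>

lemma alternating_factorization_le:
  assumes c: "c \<le> 1" and y: "y \<in> simplex_words (Suc n)" "y \<notin> horn_words (Suc n) n"
    and z: "z \<in> simplex_words (Suc n)"
    and eq: "map (alternating c (Suc n)) y = map (alternating c (Suc n)) z"
    and i: "i < length y"
  shows "z ! i \<le> y ! i"
proof -
  let ?a = "alternating c (Suc n)"
  have full: "j \<in> set y" if "j \<le> Suc n" "j \<noteq> n" for j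
    using y that by (auto simp: horn_words_def)
  have len: "length z = length y" using eq by (metis length_map)
  have same: "?a (z ! i) = ?a (y ! i)" if "i < length y" for i
    using arg_cong[OF eq, of "\<lambda>l. l ! i"] that len by simp
  have zb: "z ! i \<le> Suc n" if "i < length y" for i
    using z that len subsetD[OF _ nth_mem[of i z], of "{0..Suc n}"] by (simp add: simplex_words_def)
  have ym: "y ! i \<le> y ! j" if "i \<le> j" "j < length y" for i j
    using y(1) that by (auto simp: simplex_words_def sorted_nth_mono)
  have zm: "z ! i \<le> z ! Suc i" if "Suc i < length y" for i
    using z that len by (auto simp: simplex_words_def sorted_iff_nth_Suc)
  show ?thesis using i
  proof (induction "length y - i" arbitrary: i)
    case (Suc d)
    show ?case
    proof (cases "y ! i \<ge> Suc n")
      case True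
      with zb[OF Suc.prems] show ?thesis by simp
    next
      case False
      obtain e where e: "e < length y" "y ! e = Suc n" using full[of "Suc n"] by (auto simp: in_set_conv_nth)
      then have "i < e" using ym[of e i] False Suc.prems by (cases "i < e") auto
      then have si: "Suc i < length y" using e by simp
      have IH: "z ! Suc i \<le> y ! Suc i" using Suc si by simp
      have gap: "j \<notin> set y" if "y ! i < j" "j < y ! Suc i" for j
      proof
        assume "j \<in> set y"
        then obtain q where "q < length y" "y ! q = j" by (auto simp: in_set_conv_nth)
        with that ym[of q i] ym[of "Suc i" q] si show False by (cases "q \<le> i") auto
      qed
      have ysb: "y ! Suc i \<le> Suc n"
        using y(1) si subsetD[OF _ nth_mem[of "Suc i" y], of "{0..Suc n}"]
        by (simp add: simplex_words_def)
      consider "y ! Suc i = y ! i" | "y ! Suc i = Suc (y ! i)"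
        | "y ! Suc i = Suc n" "n = Suc (y ! i)"
      proof -
        have "y ! i \<le> y ! Suc i" using ym[of i "Suc i"] si by simp
        moreover have "Suc (y ! i) = n \<or> \<not> Suc (y ! i) < y ! Suc i"
          using gap[of "Suc (y ! i)"] full[of "Suc (y ! i)"] ysb by auto
        moreover have "y ! Suc i = Suc n" if "Suc (y ! i) = n" "Suc (y ! i) < y ! Suc i"
          using that ysb by simp
        ultimately show ?thesis using that by linarith
      qed
      then show ?thesis
      proof cases
        case 1
        then show ?thesis using zm[OF si] IH by simp
      next
        case 2
        then have "z ! i \<noteq> Suc (y ! i)"
          using same[OF Suc.prems] alternating_neq_Suc[OF c, of "y ! i" "Suc n"] False by auto
        then show ?thesis using zm[OF si] IH 2 by simp
      next
        case 3
        have "z ! i \<noteq> n"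
          using same[OF Suc.prems] alternating_neq_Suc[OF c, of "y ! i" "Suc n"] 3 by auto
        moreover have "z ! i \<noteq> Suc n"
          using same[OF Suc.prems] alternating_letter[OF c, of "y ! i" "Suc n"] 3
          by (auto simp: alternating_def)
        ultimately show ?thesis using zb[OF Suc.prems] 3 by simp
      qed
    qed
  qed simp
qed

text \<open>
  A factorization in \<open>stage c n\<close> would start at a position \<open>\<ge> 1\<close> of the alternating simplex of dimension
  \<open>n + 1\<close>, whereas the largest one starts at \<open>0\<close>.
\<close>

lemma stage_new_simplex:
  assumes c: "c \<le> 1" and y: "y \<in> simplex_words (Suc n)" "y \<notin> horn_words (Suc n) n"
    and n: "0 < n"
  shows "map (alternating c (Suc n)) y \<notin> stage c n"
proof
  assume "map (alternating c (Suc n)) y \<in> stage c n"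
  then consider "set (map (alternating c (Suc n)) y) \<subseteq> {0, 1}"
    | w where "w \<in> simplex_words n" "map (alternating c (Suc n)) y = map (alternating c n) w"
    unfolding stage_def by blast
  then show False
  proof cases
    case 1
    have "Suc n \<in> set y" using y by (force simp: horn_words_def)
    then have "alternating c (Suc n) (Suc n) \<in> {0, 1}" using 1 by auto
    then show False by (simp add: alternating_def)
  next
    case (2 w)
    have 0: "0 \<in> set y" using y n by (auto simp: horn_words_def)
    then obtain q where q: "q < length y" "y ! q = 0" by (auto simp: in_set_conv_nth)
    have "map Suc w \<in> simplex_words (Suc n)"
      using 2(1) by (auto simp: simplex_words_def sorted_map)
    moreover have eq: "map (alternating c (Suc n)) y = map (alternating c (Suc n)) (map Suc w)"
      using 2(2) by (simp add: alternating_Suc comp_def)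
    ultimately have "map Suc w ! q \<le> y ! q"
      using alternating_factorization_le[OF c y] q(1) by blast
    moreover have "length w = length y" using 2(2) by (metis length_map)
    ultimately show False using q by simp
  qed
qed

lemma stage_new_unique:
  assumes c: "c \<le> 1" and y: "y \<in> simplex_words (Suc n)" "z \<in> simplex_words (Suc n)"
    and eq: "map (alternating c (Suc n)) y = map (alternating c (Suc n)) z"
    and new: "map (alternating c (Suc n)) y \<notin> stage c n"
  shows "y = z"
proof -
  have "y \<notin> horn_words (Suc n) n" "z \<notin> horn_words (Suc n) n"
    using stage_horn[OF c] new eq by metis+
  then have "y ! i = z ! i" if "i < length y" for i
    using alternating_factorization_le[OF c y(1) _ y(2) eq that]
      alternating_factorization_le[OF c y(2) _ y(1) eq[symmetric], of i] that
      arg_cong[OF eq, of length] by auto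
  then show ?thesis using arg_cong[OF eq, of length] by (auto intro: nth_equalityI)
qed

text \<open>
  The map is defined on the horn by the previous stage; a filler of this horn defines it on the new
  simplices, which factor uniquely through the alternating one.
\<close>

lemma extend_stage_Suc:
  assumes Y: "quasi_category Y" and c: "c \<le> 1" and n: "0 < n" and G: "word_map (stage c n) Y G"
  obtains G' where "word_map (stage c (Suc n)) Y G'" "\<And>w. w \<in> stage c n \<Longrightarrow> G' w = G w"
proof -
  let ?a = "map (alternating c (Suc n))"
  have "word_map (horn_words (Suc n) n) Y (\<lambda>y. G (?a y))"
    by (rule word_map_comp[OF G word_closed_horn stage_horn[OF c]])
  then obtain F where F: "word_map (simplex_words (Suc n)) Y F"
    and FG: "\<And>y. y \<in> horn_words (Suc n) n \<Longrightarrow> F y = G (?a y)"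
    using quasi_category_fills_horn_words[OF Y n lessI] by metis
  define G' where "G' w = (if w \<in> stage c n then G w
    else F (SOME y. y \<in> simplex_words (Suc n) \<and> ?a y = w))" for w
  have old: "G' w = G w" if "w \<in> stage c n" for w
    using that by (simp add: G'_def)
  have new: "G' (?a y) = F y" if y: "y \<in> simplex_words (Suc n)" for y
  proof (cases "?a y \<in> stage c n")
    case True
    then have "y \<in> horn_words (Suc n) n" using stage_new_simplex[OF c y _ n] by blast
    with True FG old show ?thesis by simp
  next
    case False
    then have "(SOME z. z \<in> simplex_words (Suc n) \<and> ?a z = ?a y) = y"
      using stage_new_unique[OF c _ y] y by (intro some_equality) auto
    with False show ?thesis by (simp add: G'_def)
  qed
  show ?thesis
  proof (rule that[of G'])
    show "word_map (stage c (Suc n)) Y G'"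
      unfolding word_map_def
    proof (intro ballI)
      fix w assume w: "w \<in> stage c (Suc n)"
      show "G' w \<in> simplices Y (length w - 1) \<and> (\<forall>m. \<forall>\<theta>\<in>ord_maps m (length w - 1).
        G' (map (nth w) \<theta>) = act Y (length w - 1) \<theta> (G' w))"
      proof (cases "w \<in> stage c n")
        case True
        then show ?thesis
          using G old word_closedD[OF word_closed_stage True] by (simp add: word_map_def)
      next
        case False
        with w obtain y where y: "y \<in> simplex_words (Suc n)" "w = ?a y"
          by (auto simp: stage_def)
        then have ne: "y \<noteq> []" by (simp add: simplex_words_def)
        have "G' (map (nth w) \<theta>) = act Y (length w - 1) \<theta> (G' w)"
          if th: "\<theta> \<in> ord_maps m (length w - 1)" for m \<theta>
        proof -
          have th': "\<theta> \<in> ord_maps m (length y - 1)" using th y by simp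
          have "map (nth w) \<theta> = ?a (map (nth y) \<theta>)" unfolding y(2) by (rule map_subword[OF th' ne, symmetric])
          then have "G' (map (nth w) \<theta>) = F (map (nth y) \<theta>)"
            using new[OF word_closedD[OF word_closed_simplex y(1) th']] by (rule ssubst)
          then show ?thesis using F y new[OF y(1)] th' by (simp add: word_map_def)
        qed
        moreover have "G' w \<in> simplices Y (length w - 1)"
          using F y new[OF y(1)] by (simp add: word_map_def)
        ultimately show ?thesis by blast
      qed
    qed
  qed (rule old)
qed

text \<open>
  The whole nerve of \<open>(0 \<cong> 1) \<rightarrow> 2\<close>: no arrow leads from \<open>2\<close> back to \<open>0\<close> or \<open>1\<close>.
\<close>

definition absorbing_words :: "nat list set" where
  "absorbing_words = {w. w \<noteq> [] \<and> set w \<subseteq> {0, 1, 2} \<and> sorted_wrt (\<lambda>a b. a = 2 \<longrightarrow> b = 2) w}"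

lemma stage_mono: "m \<le> n \<Longrightarrow> stage c m \<subseteq> stage c n"
  using lift_Suc_mono_le[of "stage c"] stage_Suc by blast

text \<open>
  A letter can always be prepended within the two positions that precede the old alternating simplex
  in the alternating one of dimension \<open>n + 2\<close>, as these carry both letters.
\<close>

lemma absorbing_word_in_stage:
  assumes c: "c \<le> 1" and w: "w \<in> absorbing_words"
  shows "\<exists>n. w \<in> stage c n"
  using w
proof (induction w)
  case (Cons a w)
  show ?case
  proof (cases "w = [] \<or> a = 2")
    case True
    show ?thesis
    proof (cases "a = 2")
      case True
      then have "set (a # w) \<subseteq> {2}" using Cons.prems by (auto simp: absorbing_words_def)
      then have "map (\<lambda>_. 2) (a # w) = a # w" by (intro map_idI) (auto simp del: list.map)
      then have "a # w = map (alternating c 0) (map (\<lambda>_. 0) (a # w))"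
        by (simp add: alternating_def comp_def)
      moreover have "map (\<lambda>_. 0) (a # w) \<in> simplex_words 0"
        by (auto simp: simplex_words_def sorted_iff_nth_mono nth_Cons split: nat.split)
      ultimately have "a # w \<in> map (alternating c 0) ` simplex_words 0" by (rule image_eqI)
      then have "a # w \<in> stage c 0" unfolding stage_def by (rule UnI2)
      then show ?thesis ..
    next
      case False
      with True Cons.prems have "a # w \<in> stage c 0" by (auto simp: stage_def absorbing_words_def)
      then show ?thesis ..
    qed
  next
    case False
    then have a: "a = 0 \<or> a = 1" using Cons.prems by (auto simp: absorbing_words_def)
    from False Cons obtain n where "w \<in> stage c n" by (auto simp: absorbing_words_def)
    then consider "set w \<subseteq> {0, 1}"
      | y where "y \<in> simplex_words n" "w = map (alternating c n) y"
      unfolding stage_def by blast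
    then show ?thesis
    proof cases
      case 1
      with a have "a # w \<in> stage c 0" by (auto simp: stage_def)
      then show ?thesis ..
    next
      case (2 y)
      have s: "alternating c (Suc (Suc n)) (Suc (Suc i)) = alternating c n i" for i
        by (simp add: alternating_Suc)
      have "alternating c (Suc (Suc n)) 0 = a \<or> alternating c (Suc (Suc n)) 1 = a"
        using alternating_neq_Suc[OF c, of 0 "Suc (Suc n)"]
          alternating_letter[OF c, of 0 "Suc (Suc n)"] alternating_letter[OF c, of 1 "Suc (Suc n)"] a
        by auto
      then obtain i where i: "i \<le> 1" "alternating c (Suc (Suc n)) i = a" by (metis le_refl zero_le)
      have "a # w = map (alternating c (Suc (Suc n))) (i # map (\<lambda>i. Suc (Suc i)) y)"
        using 2 i s by (simp add: comp_def)
      moreover have "i # map (\<lambda>i. Suc (Suc i)) y \<in> simplex_words (Suc (Suc n))"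
        using 2 i by (auto simp: simplex_words_def sorted_map)
      ultimately have "a # w \<in> stage c (Suc (Suc n))"
        unfolding stage_def by (intro UnI2) (rule image_eqI)
      then show ?thesis ..
    qed
  qed
qed (simp add: absorbing_words_def)

text \<open>
  Each stage in positive dimension generates the nerve by inner horn fillings: extend step by step and
  take the union.
\<close>

lemma extend_stage:
  assumes Y: "quasi_category Y" and c: "c \<le> 1" and n: "0 < n" and G: "word_map (stage c n) Y G"
  obtains G' where "word_map absorbing_words Y G'" "\<And>w. w \<in> stage c n \<Longrightarrow> G' w = G w"
proof -
  have "\<exists>H. \<forall>i. (word_map (stage c (n + i)) Y (H i) \<and> (i = 0 \<longrightarrow> H i = G)) \<and>
      (\<forall>w \<in> stage c (n + i). H (Suc i) w = H i w)"
  proof (rule dependent_nat_choice)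
    show "\<exists>H. word_map (stage c (n + 0)) Y H \<and> (0 = (0::nat) \<longrightarrow> H = G)" using G by auto
    fix H i assume "word_map (stage c (n + i)) Y H \<and> (i = 0 \<longrightarrow> H = G)"
    then obtain H' where "word_map (stage c (Suc (n + i))) Y H'"
      "\<And>w. w \<in> stage c (n + i) \<Longrightarrow> H' w = H w"
      using extend_stage_Suc[OF Y c, of "n + i" H] n by auto
    then show "\<exists>H'. (word_map (stage c (n + Suc i)) Y H' \<and> (Suc i = 0 \<longrightarrow> H' = G)) \<and>
        (\<forall>w \<in> stage c (n + i). H' w = H w)" by auto
  qed
  then obtain H where H: "\<And>i. word_map (stage c (n + i)) Y (H i)" "H 0 = G"
    "\<And>i w. w \<in> stage c (n + i) \<Longrightarrow> H (Suc i) w = H i w" by blast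
  have agree: "H (i + j) w = H i w" if "w \<in> stage c (n + i)" for i j w
    using H(3) that stage_mono[of "n + i" "n + (i + j)" for j, of _ c]
    by (induction j) (auto simp: subset_iff)
  define K where "K w = H (LEAST i. w \<in> stage c (n + i)) w" for w
  have K: "K w = H i w" if "w \<in> stage c (n + i)" for i w
  proof -
    let ?l = "LEAST i. w \<in> stage c (n + i)"
    have "w \<in> stage c (n + ?l)" "?l \<le> i"
      using that by (auto intro: LeastI Least_le)
    then show ?thesis using agree[of w ?l "i - ?l"] by (simp add: K_def)
  qed
  show ?thesis
  proof (rule that[of K])
    show "K w = G w" if "w \<in> stage c n" for w using K[of w 0] H(2) that by simp
    show "word_map absorbing_words Y K"
      unfolding word_map_def
    proof (intro ballI)
      fix w assume "w \<in> absorbing_words"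
      then obtain m where "w \<in> stage c m" using absorbing_word_in_stage[OF c] by blast
      then have w: "w \<in> stage c (n + m)" using stage_mono[of m "n + m" c] by auto
      have "K (map (nth w) \<theta>) = act Y (length w - 1) \<theta> (K w)"
        if "\<theta> \<in> ord_maps l (length w - 1)" for l \<theta>
        using H(1)[of m] K[OF w] K[OF word_closedD[OF word_closed_stage w that]] w that
        by (simp add: word_map_def)
      moreover have "K w \<in> simplices Y (length w - 1)"
        using H(1)[of m] K[OF w] w by (simp add: word_map_def)
      ultimately show "K w \<in> simplices Y (length w - 1) \<and> (\<forall>m. \<forall>\<theta>\<in>ord_maps m (length w - 1).
        K (map (nth w) \<theta>) = act Y (length w - 1) \<theta> (K w))" by blast
    qed
  qed
qed

section \<open>Simplicial sets of words as objects of the category\<close>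

lemma sSet_simps:
  "Ob sSet = {X. is_sset X}" "Dom sSet = src" "Cod sSet = trg"
  by (simp_all add: sSet_def)

lemma hom_sSet:
  "f \<in> hom sSet X Y \<longleftrightarrow>
     src f = X \<and> trg f = Y \<and> is_sset X \<and> is_sset Y \<and> sset_map X Y (fn f)"
  by (auto simp: hom_def sSet_def)

lemma smap_eqI:
  assumes "f \<in> hom sSet X Y" "g \<in> hom sSet X Y"
    and "\<And>m x. x \<in> simplices X m \<Longrightarrow> fn f m x = fn g m x"
  shows "f = g"
proof -
  have "fn f m = fn g m" for m
    using assms by (intro extensionalityI[of _ "simplices X m"])
      (auto simp: hom_sSet sset_map_def PiE_iff)
  then have "fn f = fn g" by blast
  then show ?thesis using assms(1,2) by (cases f; cases g) (simp add: hom_sSet)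
qed

lemma fn_comp:
  "f \<in> hom sSet X Y \<Longrightarrow> x \<in> simplices X m \<Longrightarrow> fn (g \<cdot>\<^bsub>sSet\<^esub> f) m x = fn g m (fn f m x)"
  by (simp add: hom_sSet) (simp add: sSet_def compose_def)

lemma fn_simplex: "f \<in> hom sSet X Y \<Longrightarrow> x \<in> simplices X m \<Longrightarrow> fn f m x \<in> simplices Y m"
  by (auto simp: hom_sSet sset_map_def PiE_iff)

lemma fn_act:
  "f \<in> hom sSet X Y \<Longrightarrow> \<theta> \<in> ord_maps m n \<Longrightarrow> x \<in> simplices X n \<Longrightarrow>
   fn f m (act X n \<theta> x) = act Y n \<theta> (fn f n x)"
  by (auto simp: hom_sSet sset_map_def)

lemma act_simplex:
  "is_sset X \<Longrightarrow> \<theta> \<in> ord_maps m n \<Longrightarrow> x \<in> simplices X n \<Longrightarrow> act X n \<theta> x \<in> simplices X m"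
  by (auto simp: is_sset_def)

lemma act_act:
  "is_sset X \<Longrightarrow> \<phi> \<in> ord_maps l m \<Longrightarrow> \<theta> \<in> ord_maps m n \<Longrightarrow> x \<in> simplices X n \<Longrightarrow>
   act X m \<phi> (act X n \<theta> x) = act X n (map (nth \<theta>) \<phi>) x"
  by (auto simp: is_sset_def)

lemma act_id: "is_sset X \<Longrightarrow> x \<in> simplices X n \<Longrightarrow> act X n [0..<Suc n] x = x"
  by (auto simp: is_sset_def simp del: upt_Suc)

text \<open>
  Simplices have to be taken from \<open>'u\<close>, into which words are embedded by \<open>e\<close>.
\<close>

locale word_encoding =
  fixes e :: "nat list \<Rightarrow> 'u"
  assumes inj: "inj e"
begin

lemma inv_e [simp]: "inv e (e x) = x"
  using inj by simp

definition word_sset :: "nat list set \<Rightarrow> 'u sset" where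
  "word_sset S = \<lparr>simplices = (\<lambda>m. e ` {x \<in> S. length x = Suc m}),
     act = (\<lambda>_ \<theta> y. e (map (nth (inv e y)) \<theta>))\<rparr>"

lemma simplices_word_sset: "simplices (word_sset S) m = e ` {x \<in> S. length x = Suc m}"
  by (simp add: word_sset_def)

lemma e_in_simplices [simp]: "e x \<in> simplices (word_sset S) m \<longleftrightarrow> x \<in> S \<and> length x = Suc m"
  using inj by (auto simp: simplices_word_sset inj_eq)

lemma act_word_sset [simp]: "act (word_sset S) n \<theta> (e x) = e (map (nth x) \<theta>)"
  by (simp add: word_sset_def)

lemma is_sset_word_sset:
  assumes S: "word_closed S"
  shows "is_sset (word_sset S)"
  unfolding is_sset_def
proof (intro conjI allI ballI)
  fix m n \<theta> y assume th: "\<theta> \<in> ord_maps m n" and "y \<in> simplices (word_sset S) n"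
  then obtain x where x: "y = e x" "x \<in> S" "length x = Suc n" by (auto simp: simplices_word_sset)
  show "act (word_sset S) n \<theta> y \<in> simplices (word_sset S) m"
    using word_closedD[OF S x(2), of \<theta> m] th x by (simp add: ord_maps_length)
next
  fix n y assume "y \<in> simplices (word_sset S) n"
  then show "act (word_sset S) n [0..<Suc n] y = y"
    by (auto simp: simplices_word_sset simp del: upt_Suc) (metis map_nth)
next
  fix l m n \<phi> \<theta> y assume "\<phi> \<in> ord_maps l m" "\<theta> \<in> ord_maps m n" "y \<in> simplices (word_sset S) n"
  then show "act (word_sset S) n (map (nth \<theta>) \<phi>) y =
      act (word_sset S) m \<phi> (act (word_sset S) n \<theta> y)"
    by (auto simp: simplices_word_sset map_nth_map ord_maps_length simp del: map_map)
qed

text \<open>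
  Every morphism out of a simplicial set of words arises in this way from a function on words, by
  \<open>smap_of_hom\<close> and \<open>smap_of_exhaust\<close>.
\<close>

definition smap_of :: "nat list set \<Rightarrow> 'u sset \<Rightarrow> (nat list \<Rightarrow> 'u) \<Rightarrow> 'u smap" where
  "smap_of S Y G = \<lparr>src = word_sset S, trg = Y,
     fn = (\<lambda>m. restrict (\<lambda>y. G (inv e y)) (simplices (word_sset S) m))\<rparr>"

lemma fn_smap_of [simp]: "x \<in> S \<Longrightarrow> length x = Suc m \<Longrightarrow> fn (smap_of S Y G) m (e x) = G x"
  by (simp add: smap_of_def)

lemma smap_of_hom:
  assumes S: "word_closed S" and Y: "is_sset Y" and G: "word_map S Y G"
  shows "smap_of S Y G \<in> hom sSet (word_sset S) Y"
proof -
  have "sset_map (word_sset S) Y (fn (smap_of S Y G))"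
    unfolding sset_map_def
  proof (intro conjI allI ballI)
    fix m
    show "fn (smap_of S Y G) m \<in> simplices (word_sset S) m \<rightarrow>\<^sub>E simplices Y m"
      using G by (auto simp: smap_of_def simplices_word_sset word_map_def)
  next
    fix m n \<theta> y assume th: "\<theta> \<in> ord_maps m n" and "y \<in> simplices (word_sset S) n"
    then obtain x where x: "y = e x" "x \<in> S" "length x = Suc n"
      by (auto simp: simplices_word_sset)
    have "map (nth x) \<theta> \<in> S" using word_closedD[OF S x(2), of \<theta> m] th x by simp
    then show "fn (smap_of S Y G) m (act (word_sset S) n \<theta> y) =
        act Y n \<theta> (fn (smap_of S Y G) n y)"
      using G th x by (simp add: ord_maps_length word_map_def)
  qed
  then show ?thesis using S Y by (simp add: hom_sSet is_sset_word_sset) (simp add: smap_of_def)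
qed

lemma smap_of_exhaust:
  assumes S: "word_closed S" and f: "f \<in> hom sSet (word_sset S) Y"
  obtains G where "word_map S Y G" "f = smap_of S Y G"
proof -
  let ?G = "\<lambda>x. fn f (length x - 1) (e x)"
  have ne: "x \<noteq> []" if "x \<in> S" for x using S that by (auto simp: word_closed_def)
  have lev: "e x \<in> simplices (word_sset S) (length x - 1)" if "x \<in> S" for x
    using that ne[OF that] by simp
  have G: "word_map S Y ?G"
    unfolding word_map_def
  proof (intro ballI conjI allI)
    fix x assume x: "x \<in> S"
    show "?G x \<in> simplices Y (length x - 1)" by (rule fn_simplex[OF f lev[OF x]])
    fix m \<theta> assume "\<theta> \<in> ord_maps m (length x - 1)"
    then show "?G (map (nth x) \<theta>) = act Y (length x - 1) \<theta> (?G x)"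
      using fn_act[OF f _ lev[OF x], of \<theta> m] by (simp add: ord_maps_length)
  qed
  have "is_sset Y" using f by (simp add: hom_sSet)
  have "f = smap_of S Y ?G"
    by (rule smap_eqI[OF f smap_of_hom[OF S \<open>is_sset Y\<close> G]]) (auto simp: simplices_word_sset)
  with G show ?thesis by (rule that)
qed

lemma smap_of_cong: "(\<And>x. x \<in> S \<Longrightarrow> G x = H x) \<Longrightarrow> smap_of S Y G = smap_of S Y H"
  by (auto simp: smap_of_def simplices_word_sset fun_eq_iff restrict_def)

definition letter_map :: "(nat \<Rightarrow> nat) \<Rightarrow> nat list set \<Rightarrow> nat list set \<Rightarrow> 'u smap" where
  "letter_map f S T = smap_of S (word_sset T) (\<lambda>x. e (map f x))"

lemma word_map_e: "word_closed S \<Longrightarrow> word_map S (word_sset S) e"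
  by (auto simp: word_map_def word_closed_def)

lemma letter_map_hom:
  assumes "word_closed S" "word_closed T" "\<And>x. x \<in> S \<Longrightarrow> map f x \<in> T"
  shows "letter_map f S T \<in> hom sSet (word_sset S) (word_sset T)"
  unfolding letter_map_def
  by (intro smap_of_hom is_sset_word_sset word_map_comp[OF word_map_e] assms)

lemma comp_letter_map:
  assumes S: "word_closed S" and T: "word_closed T" and f: "\<And>x. x \<in> S \<Longrightarrow> map f x \<in> T"
    and Y: "is_sset Y" and H: "word_map T Y H"
  shows "smap_of T Y H \<cdot>\<^bsub>sSet\<^esub> letter_map f S T = smap_of S Y (\<lambda>x. H (map f x))"
proof (rule smap_eqI)
  note h = letter_map_hom[OF S T f]
  show "smap_of T Y H \<cdot>\<^bsub>sSet\<^esub> letter_map f S T \<in> hom sSet (word_sset S) Y"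
    by (rule hom_comp[OF is_category_sSet h smap_of_hom[OF T Y H]])
  show "smap_of S Y (\<lambda>x. H (map f x)) \<in> hom sSet (word_sset S) Y"
    by (rule smap_of_hom[OF S Y word_map_comp[OF H S f]])
  fix m y assume y: "y \<in> simplices (word_sset S) m"
  then show "fn (smap_of T Y H \<cdot>\<^bsub>sSet\<^esub> letter_map f S T) m y = fn (smap_of S Y (\<lambda>x. H (map f x))) m y"
    using f by (auto simp: fn_comp[OF h y] simplices_word_sset) (simp add: letter_map_def)
qed

lemma letter_map_comp:
  assumes "word_closed S" "word_closed T" "word_closed U"
    and "\<And>x. x \<in> S \<Longrightarrow> map f x \<in> T" "\<And>x. x \<in> T \<Longrightarrow> map g x \<in> U"
  shows "letter_map g T U \<cdot>\<^bsub>sSet\<^esub> letter_map f S T = letter_map (g \<circ> f) S U"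
  unfolding letter_map_def[of g] letter_map_def[of "g \<circ> f"]
  using comp_letter_map[OF assms(1,2,4) is_sset_word_sset[OF assms(3)]
    word_map_comp[OF word_map_e[OF assms(3)] assms(2,5)]] by simp

lemma letter_map_id:
  assumes "word_closed S" "\<And>x. x \<in> S \<Longrightarrow> map f x = x"
  shows "letter_map f S S = Idn sSet (word_sset S)"
proof (rule smap_eqI)
  show "letter_map f S S \<in> hom sSet (word_sset S) (word_sset S)"
    using assms by (intro letter_map_hom) auto
  show "Idn sSet (word_sset S) \<in> hom sSet (word_sset S) (word_sset S)"
    using is_sset_word_sset[OF assms(1)] by (intro id_hom is_category_sSet) (simp add: sSet_simps)
  fix m y assume "y \<in> simplices (word_sset S) m"
  then show "fn (letter_map f S S) m y = fn (Idn sSet (word_sset S)) m y"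
    using assms(2) by (auto simp: simplices_word_sset letter_map_def) (auto simp: sSet_def)
qed

abbreviation inclusion :: "nat list set \<Rightarrow> nat list set \<Rightarrow> 'u smap" where
  "inclusion \<equiv> letter_map id"

lemma inclusion_hom:
  "word_closed S \<Longrightarrow> word_closed T \<Longrightarrow> S \<subseteq> T \<Longrightarrow>
   inclusion S T \<in> hom sSet (word_sset S) (word_sset T)"
  by (rule letter_map_hom) auto

lemma fn_inclusion: "y \<in> simplices (word_sset S) m \<Longrightarrow> fn (inclusion S T) m y = y"
  by (auto simp: simplices_word_sset letter_map_def)

text \<open>
  Inclusions leave the underlying elements of \<open>'u\<close> unchanged, so the factorization is the same function.
\<close>

lemma inclusion_factor:
  assumes S: "word_closed S" and T: "word_closed T" and ST: "S \<subseteq> T"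
    and v: "v \<in> hom sSet X (word_sset T)"
    and im: "\<And>m x. x \<in> simplices X m \<Longrightarrow> fn v m x \<in> simplices (word_sset S) m"
  shows "\<exists>h \<in> hom sSet X (word_sset S). inclusion S T \<cdot>\<^bsub>sSet\<^esub> h = v"
proof
  let ?h = "\<lparr>src = X, trg = word_sset S, fn = fn v\<rparr>"
  show h: "?h \<in> hom sSet X (word_sset S)"
    using v im is_sset_word_sset[OF S]
    by (auto simp: hom_sSet sset_map_def PiE_iff word_sset_def)
  show "inclusion S T \<cdot>\<^bsub>sSet\<^esub> ?h = v"
  proof (rule smap_eqI[OF hom_comp[OF is_category_sSet h inclusion_hom[OF S T ST]] v])
    fix m x assume x: "x \<in> simplices X m"
    show "fn (inclusion S T \<cdot>\<^bsub>sSet\<^esub> ?h) m x = fn v m x"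
      using fn_comp[OF h x] fn_inclusion[OF im[OF x]] by simp
  qed
qed

lemma inclusion_mono:
  assumes S: "word_closed S" and T: "word_closed T" and ST: "S \<subseteq> T"
  shows "monomorphism sSet (inclusion S T)"
  unfolding monomorphism_def
proof (intro conjI allI ballI impI)
  note i = inclusion_hom[OF assms]
  then have D: "Dom sSet (inclusion S T) = word_sset S" by (simp add: hom_def)
  show "inclusion S T \<in> Ar sSet" using i by (rule hom_Ar)
  fix Z g h
  assume "g \<in> hom sSet Z (Dom sSet (inclusion S T))" "h \<in> hom sSet Z (Dom sSet (inclusion S T))"
    and eq: "inclusion S T \<cdot>\<^bsub>sSet\<^esub> g = inclusion S T \<cdot>\<^bsub>sSet\<^esub> h"
  then have g: "g \<in> hom sSet Z (word_sset S)" and h: "h \<in> hom sSet Z (word_sset S)"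
    by (simp_all add: D)
  show "g = h"
  proof (rule smap_eqI[OF g h])
    fix m z assume z: "z \<in> simplices Z m"
    show "fn g m z = fn h m z"
      using fn_comp[OF g z, of "inclusion S T"] fn_comp[OF h z, of "inclusion S T"] eq
        fn_inclusion[OF fn_simplex[OF g z]] fn_inclusion[OF fn_simplex[OF h z]] by metis
  qed
qed

text \<open>
  The zero-simplex, which serves both as terminal object and to test injectivity on vertices.
\<close>

definition point :: "nat list set" where
  "point = {w. w \<noteq> [] \<and> set w \<subseteq> {0}}"

lemma point_iff: "w \<in> point \<longleftrightarrow> w \<noteq> [] \<and> w = replicate (length w) 0"
  by (auto simp: point_def replicate_eqI intro: replicate_eqI dest: arg_cong[where f = set])

lemma word_closed_point: "word_closed point"
  unfolding point_def by (rule word_closed_letters)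

lemma replicate_ord_maps: "replicate (Suc m) 0 \<in> ord_maps m n"
  by (auto simp: ord_maps_def)

lemma simplices_point: "simplices (word_sset point) m = {e (replicate (Suc m) 0)}"
proof -
  have "{x \<in> point. length x = Suc m} = {replicate (Suc m) 0}"
    using point_iff by fastforce
  then show ?thesis by (simp only: simplices_word_sset) simp
qed

lemma terminal_point: "terminal sSet (word_sset point)"
  unfolding terminal_def
proof (intro conjI ballI)
  show P: "word_sset point \<in> Ob sSet"
    by (simp add: sSet_simps is_sset_word_sset[OF word_closed_point])
  fix X :: "'u sset" assume "X \<in> Ob sSet"
  then have X: "is_sset X" by (simp add: sSet_simps)
  let ?f = "\<lparr>src = X, trg = word_sset point,
    fn = (\<lambda>m. restrict (\<lambda>x. e (replicate (Suc m) 0)) (simplices X m))\<rparr>"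
  have "map (nth (replicate (Suc n) 0)) \<theta> = replicate (Suc m) (0::nat)"
    if "\<theta> \<in> ord_maps m n" for m n \<theta>
    using that by (intro replicate_eqI) (auto simp: ord_maps_def less_Suc_eq_le subset_iff nth_Cons split: nat.split)
  then have "?f \<in> hom sSet X (word_sset point)"
    using X P act_simplex[OF X]
    by (auto simp: hom_sSet sSet_simps sset_map_def simplices_point simp del: replicate_Suc)
  moreover have "f = g" if "f \<in> hom sSet X (word_sset point)" "g \<in> hom sSet X (word_sset point)"
    for f g
    using fn_simplex[OF that(1)] fn_simplex[OF that(2)]
    by (intro smap_eqI[OF that]) (simp add: simplices_point del: replicate_Suc)
  ultimately show "\<exists>!f. f \<in> hom sSet X (word_sset point)" by blast
qed

text \<open>
  A vertex is the same as a map from the point, and a monomorphism can be cancelled from these.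
\<close>

lemma mono_inj_vertices:
  fixes i :: "'u smap"
  assumes m: "monomorphism sSet i" and i: "i \<in> hom sSet A B"
    and a: "a \<in> simplices A 0" "b \<in> simplices A 0" and eq: "fn i 0 a = fn i 0 b"
  shows "a = b"
proof -
  have A: "is_sset A" and B: "is_sset B" using i by (auto simp: hom_sSet)
  define G where "G x w = act A 0 (replicate (length w) 0) x" for x :: 'u and w :: "nat list"
  have wm: "word_map point A (G x)" if x: "x \<in> simplices A 0" for x
    unfolding word_map_def
  proof (intro ballI conjI allI)
    fix w assume "w \<in> point"
    then obtain l where l: "length w = Suc l" by (cases w) (auto simp: point_def)
    show "G x w \<in> simplices A (length w - 1)"
      unfolding G_def l using act_simplex[OF A replicate_ord_maps x] by simp
    fix m \<theta> assume th: "\<theta> \<in> ord_maps m (length w - 1)"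
    then have "map (nth (replicate (Suc l) 0)) \<theta> = replicate (Suc m) (0::nat)"
      using l by (intro replicate_eqI) (auto simp: ord_maps_def less_Suc_eq_le subset_iff nth_Cons split: nat.split)
    then show "G x (map (nth w) \<theta>) = act A (length w - 1) \<theta> (G x w)"
      using act_act[OF A _ replicate_ord_maps x, of \<theta> m l] th l
      by (simp add: G_def ord_maps_length del: replicate_Suc)
  qed
  let ?p = "\<lambda>x. smap_of point A (G x)"
  have p: "?p x \<in> hom sSet (word_sset point) A" if "x \<in> simplices A 0" for x
    by (rule smap_of_hom[OF word_closed_point A wm[OF that]])
  have "i \<cdot>\<^bsub>sSet\<^esub> ?p a = i \<cdot>\<^bsub>sSet\<^esub> ?p b"
  proof (rule smap_eqI[OF hom_comp[OF is_category_sSet p[OF a(1)] i] hom_comp[OF is_category_sSet p[OF a(2)] i]])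
    fix m y assume y: "y \<in> simplices (word_sset point) m"
    then obtain w where w: "y = e w" "w \<in> point" "length w = Suc m"
      by (auto simp: simplices_word_sset)
    have "fn i m (G x w) = act B 0 (replicate (Suc m) 0) (fn i 0 x)" if "x \<in> simplices A 0" for x
      using fn_act[OF i replicate_ord_maps that, of m] w by (simp add: G_def)
    then show "fn (i \<cdot>\<^bsub>sSet\<^esub> ?p a) m y = fn (i \<cdot>\<^bsub>sSet\<^esub> ?p b) m y"
      using fn_comp[OF p[OF a(1)] y] fn_comp[OF p[OF a(2)] y] w a eq by simp
  qed
  then have "?p a = ?p b" by (rule mono_cancel[OF m i p[OF a(1)] p[OF a(2)]])
  then have "fn (?p a) 0 (e [0]) = fn (?p b) 0 (e [0])" by simp
  then have "G a [0] = G b [0]" by (simp add: point_def)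
  then show ?thesis using act_id[OF A a(1)] act_id[OF A a(2)] by (simp add: G_def)
qed

end

section \<open>Cylinders\<close>

text \<open>
  The product with the nerve \<open>J\<close> of the contractible groupoid on two objects: the letter \<open>2 * i + b\<close>
  stands for the pair \<open>(i, b)\<close>. Since all pairs of objects of that groupoid are connected by exactly one
  arrow, the second components of a word are arbitrary.
\<close>

definition cylinder :: "nat list set \<Rightarrow> nat list set" where
  "cylinder S = {w. map (\<lambda>i. i div 2) w \<in> S}"

lemma word_closed_cylinder:
  assumes S: "word_closed S"
  shows "word_closed (cylinder S)"
  unfolding word_closed_def
proof (intro ballI conjI allI)
  fix w assume "w \<in> cylinder S"
  then have w: "map (\<lambda>i. i div 2) w \<in> S" by (simp add: cylinder_def)
  then show ne: "w \<noteq> []" using S by (auto simp: word_closed_def)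
  fix m \<theta> assume th: "\<theta> \<in> ord_maps m (length w - 1)"
  with word_closedD[OF S w, of \<theta> m] show "map (nth w) \<theta> \<in> cylinder S"
    unfolding cylinder_def mem_Collect_eq map_subword[OF th ne] by simp
qed

context word_encoding
begin

text \<open>
  A map into \<open>J\<close> is an arbitrary function on vertices with values in \<open>{0, 1}\<close>, and such a function
  extends along every map that is injective on vertices.
\<close>

lemma cylinder_projection_lifting:
  fixes i :: "'u smap"
  assumes S: "word_closed S" and m: "monomorphism sSet i"
  shows "has_lifting sSet i (letter_map (\<lambda>i. i div 2) (cylinder S) S)"
proof -
  let ?p = "letter_map (\<lambda>i. i div 2) (cylinder S) S"
  note D = word_closed_cylinder[OF S]
  have p: "?p \<in> hom sSet (word_sset (cylinder S)) (word_sset S)"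
    by (rule letter_map_hom[OF D S]) (simp add: cylinder_def)
  obtain A B where i: "i \<in> hom sSet A B"
    using m by (auto simp: monomorphism_def hom_def)
  then have A: "is_sset A" and B: "is_sset B" by (auto simp: hom_sSet)
  show ?thesis
  proof (rule liftingI[OF i p])
    fix u v assume u: "u \<in> hom sSet A (word_sset (cylinder S))"
      and v: "v \<in> hom sSet B (word_sset S)" and uv: "?p \<cdot>\<^bsub>sSet\<^esub> u = v \<cdot>\<^bsub>sSet\<^esub> i"
    \<comment> \<open>the second component of the lift, prolonged by the default value \<open>0\<close> outside the image of \<open>i\<close>\<close>
    define side where "side b = (if \<exists>a \<in> simplices A 0. fn i 0 a = b
      then hd (inv e (fn u 0 (SOME a. a \<in> simplices A 0 \<and> fn i 0 a = b))) mod 2 else 0)" for b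
    have side_i: "side (fn i 0 a) = hd (inv e (fn u 0 a)) mod 2" if a: "a \<in> simplices A 0" for a
    proof -
      have "(SOME a'. a' \<in> simplices A 0 \<and> fn i 0 a' = fn i 0 a) = a"
        using a mono_inj_vertices[OF m i _ a] by (intro some_equality) auto
      with a show ?thesis by (auto simp: side_def)
    qed
    have side_less: "side b < 2" for b by (simp add: side_def)
    \<comment> \<open>first components are prescribed by \<open>v\<close>, second ones by the vertices of the simplex\<close>
    define h where "h m z = map (\<lambda>j. 2 * (inv e (fn v m z) ! j) + side (act B m [j] z)) [0..<Suc m]"
      for m z
    have vertex: "[j] \<in> ord_maps 0 m" if "j \<le> m" for j m
      using that by (simp add: ord_maps_def)
    have vz: "\<exists>w. fn v m z = e w \<and> w \<in> S \<and> length w = Suc m" if "z \<in> simplices B m" for m z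
      using fn_simplex[OF v that] by (auto simp: simplices_word_sset)
    have hv: "e (map (\<lambda>i. i div 2) (h m z)) = fn v m z" if z: "z \<in> simplices B m" for m z
    proof -
      obtain w where w: "fn v m z = e w" "length w = Suc m" using vz[OF z] by blast
      have "map (\<lambda>i. i div 2) (h m z) = w"
        using w side_less by (intro nth_equalityI) (simp_all add: h_def del: upt_Suc)
      with w show ?thesis by simp
    qed
    have hS: "h m z \<in> cylinder S \<and> length (h m z) = Suc m" if z: "z \<in> simplices B m" for m z
    proof -
      obtain w where "fn v m z = e w" "w \<in> S" using vz[OF z] by blast
      with hv[OF z] inj show ?thesis by (simp add: cylinder_def inj_eq) (simp add: h_def)
    qed
    let ?h = "\<lparr>src = B, trg = word_sset (cylinder S),
      fn = (\<lambda>m. restrict (\<lambda>z. e (h m z)) (simplices B m))\<rparr>"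
    have h_nat: "h l (act B m \<theta> z) = map (nth (h m z)) \<theta>"
      if th: "\<theta> \<in> ord_maps l m" and z: "z \<in> simplices B m" for l m \<theta> z
    proof (rule nth_equalityI)
      have len: "length \<theta> = Suc l" using th by (rule ord_maps_length)
      then show "length (h l (act B m \<theta> z)) = length (map (nth (h m z)) \<theta>)" by (simp add: h_def)
      fix j assume "j < length (h l (act B m \<theta> z))"
      then have j: "j \<le> l" by (simp add: h_def)
      then have tj: "\<theta> ! j \<le> m"
        using th nth_mem[of j \<theta>] by (auto simp: ord_maps_def subset_iff less_Suc_eq_le)
      obtain w where w: "fn v m z = e w" "length w = Suc m" using vz[OF z] by blast
      have "fn v l (act B m \<theta> z) = e (map (nth w) \<theta>)" using fn_act[OF v th z] w by simp
      moreover have "act B l [j] (act B m \<theta> z) = act B m [\<theta> ! j] z"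
        using act_act[OF B vertex[OF j] th z] by simp
      ultimately show "h l (act B m \<theta> z) ! j = map (nth (h m z)) \<theta> ! j"
        using j tj len w by (simp add: h_def less_Suc_eq_le del: upt_Suc)
    qed
    have h: "?h \<in> hom sSet B (word_sset (cylinder S))"
      using B is_sset_word_sset[OF D] hS h_nat act_simplex[OF B]
      by (auto simp: hom_sSet sset_map_def)
    have "?h \<cdot>\<^bsub>sSet\<^esub> i = u"
    proof (rule smap_eqI[OF hom_comp[OF is_category_sSet i h] u])
      fix m x assume x: "x \<in> simplices A m"
      note ix = fn_simplex[OF i x]
      obtain w where w: "fn u m x = e w" "w \<in> cylinder S" "length w = Suc m"
        using fn_simplex[OF u x] by (auto simp: simplices_word_sset)
      have "fn v m (fn i m x) = fn ?p m (fn u m x)"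
        using fn_comp[OF i x, of v] fn_comp[OF u x, of ?p] uv by simp
      then have vi: "fn v m (fn i m x) = e (map (\<lambda>i. i div 2) w)"
        using w by (simp add: letter_map_def)
      have "h m (fn i m x) = w"
      proof (rule nth_equalityI)
        show "length (h m (fn i m x)) = length w" using w by (simp add: h_def)
        fix j assume "j < length (h m (fn i m x))"
        then have j: "j \<le> m" by (simp add: h_def)
        note jx = act_simplex[OF A vertex[OF j] x]
        have "act B m [j] (fn i m x) = fn i 0 (act A m [j] x)"
          using fn_act[OF i vertex[OF j] x] by simp
        moreover have "fn u 0 (act A m [j] x) = e [w ! j]"
          using fn_act[OF u vertex[OF j] x] w by simp
        ultimately have "side (act B m [j] (fn i m x)) = w ! j mod 2"
          using side_i[OF jx] by simp
        then show "h m (fn i m x) ! j = w ! j"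
          using j w vi by (simp add: h_def less_Suc_eq_le del: upt_Suc)
      qed
      with w ix show "fn (?h \<cdot>\<^bsub>sSet\<^esub> i) m x = fn u m x"
        by (simp add: fn_comp[OF i x])
    qed
    moreover have "?p \<cdot>\<^bsub>sSet\<^esub> ?h = v"
    proof (rule smap_eqI[OF hom_comp[OF is_category_sSet h p] v])
      fix m z assume z: "z \<in> simplices B m"
      then show "fn (?p \<cdot>\<^bsub>sSet\<^esub> ?h) m z = fn v m z"
        using hS[OF z] hv[OF z] by (simp add: fn_comp[OF h z]) (simp add: letter_map_def)
    qed
    ultimately show "\<exists>h \<in> hom sSet B (word_sset (cylinder S)). h \<cdot>\<^bsub>sSet\<^esub> i = u \<and> ?p \<cdot>\<^bsub>sSet\<^esub> h = v"
      using h by blast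
  qed
qed

end

section \<open>Deformation onto the interval\<close>

text \<open>
  The interval spanned by \<open>0\<close> and \<open>2\<close>, onto which the nerve of \<open>(0 \<cong> 1) \<rightarrow> 2\<close> retracts.
\<close>

definition arrow_words :: "nat list set" where
  "arrow_words = {w. w \<noteq> [] \<and> sorted w \<and> set w \<subseteq> {0, 2}}"

lemma absorbing_sortedI:
  assumes "w \<noteq> []" "sorted w" "set w \<subseteq> {0, 1, 2}"
  shows "w \<in> absorbing_words"
proof -
  have "sorted_wrt (\<lambda>a b. a = 2 \<longrightarrow> b = 2) w"
    using assms(2) by (rule sorted_wrt_mono_rel[rotated]) (use assms(3) in fastforce)
  with assms show ?thesis by (simp add: absorbing_words_def)
qed

lemma word_closed_arrow: "word_closed arrow_words"
  unfolding arrow_words_def by (rule word_closed_sorted)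

definition retract_letter :: "nat \<Rightarrow> nat" where
  "retract_letter i = (if i = 2 then 2 else 0)"

lemma retract_absorbing: 
  assumes "w \<in> absorbing_words"
  shows "map retract_letter w \<in> arrow_words"
proof -
  have "sorted (map retract_letter w)"
    using assms unfolding sorted_map absorbing_words_def
    by (auto intro: sorted_wrt_mono_rel[rotated] simp: retract_letter_def)
  with assms show ?thesis by (auto simp: arrow_words_def absorbing_words_def retract_letter_def)
qed

lemma retract_arrow: "w \<in> arrow_words \<Longrightarrow> map retract_letter w = w"
  by (rule map_idI) (auto simp: arrow_words_def retract_letter_def)

context word_encoding
begin

text \<open>
  Let \<open>g\<close> be the inclusion and \<open>r\<close> the retraction that sends \<open>1\<close> to \<open>0\<close>. Inside the nerve there
  is a homotopy from the identity to \<open>g \<circ> r\<close>, given by the isomorphism \<open>1 \<cong> 0\<close>, but in general not inside \<open>S\<close>.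
  After composition with a fibrant replacement \<open>k : S \<rightarrow> Y\<close> it becomes available, because \<open>k\<close> extends
  to the nerve. Thus \<open>k \<circ> g \<circ> r\<close> is homotopic to the weak equivalence \<open>k\<close>, whence \<open>g \<circ> r\<close> and its
  retract \<open>g\<close> are weak equivalences.
\<close>

lemma arrow_inclusion_weq:
  fixes W K F :: "'u smap set"
  assumes J: "joyal_model_structure W K F" and S: "word_closed S"
    and sub: "arrow_words \<subseteq> S" "S \<subseteq> absorbing_words"
    and ext: "\<And>(Y :: 'u sset) G. quasi_category Y \<Longrightarrow> word_map S Y G \<Longrightarrow>
      \<exists>G'. word_map absorbing_words Y G' \<and> (\<forall>w \<in> S. G' w = G w)"
  shows "inclusion arrow_words S \<in> W"
proof -
  have M: "model_structure sSet W K F" and K: "K = {f. monomorphism sSet f}"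
    and fib: "\<And>X. X \<in> Ob sSet \<Longrightarrow> fibrant sSet F X \<longleftrightarrow> quasi_category X"
    using J unfolding joyal_model_structure_def by auto
  note C = is_category_sSet and D = word_closed_cylinder[OF S] and P = word_closed_arrow
  have rS: "map retract_letter w \<in> arrow_words" if "w \<in> S" for w
    using retract_absorbing that sub by blast
  let ?g = "inclusion arrow_words S" and ?r = "letter_map retract_letter S arrow_words"
  have g: "?g \<in> hom sSet (word_sset arrow_words) (word_sset S)"
    by (rule inclusion_hom[OF P S sub(1)])
  have r: "?r \<in> hom sSet (word_sset S) (word_sset arrow_words)"
    by (rule letter_map_hom[OF S P rS])
  have rg: "?r \<cdot>\<^bsub>sSet\<^esub> ?g = Idn sSet (word_sset arrow_words)"
    using letter_map_comp[OF P S P, of id retract_letter] sub(1) rS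
      letter_map_id[OF P retract_arrow] by auto
  have gr: "?g \<cdot>\<^bsub>sSet\<^esub> ?r = letter_map retract_letter S S"
    using letter_map_comp[OF S P S, of retract_letter id] sub(1) rS by auto
  have grh: "letter_map retract_letter S S \<in> hom sSet (word_sset S) (word_sset S)"
    using hom_comp[OF C r g] gr by simp
  have "word_sset S \<in> Ob sSet" using is_sset_word_sset[OF S] by (simp add: sSet_simps)
  from fibrant_replacement[OF C M terminal_point this] obtain k Y where
    k: "k \<in> hom sSet (word_sset S) Y" "k \<in> W" and "fibrant sSet F Y" .
  then have Y: "quasi_category Y" "is_sset Y"
    using fib[of Y] by (auto simp: fibrant_def quasi_category_def)
  obtain G where G: "word_map S Y G" "k = smap_of S Y G" using smap_of_exhaust[OF S k(1)] .
  obtain N where N: "word_map absorbing_words Y N" "\<And>w. w \<in> S \<Longrightarrow> N w = G w"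
    using ext[OF Y(1) G(1)] by blast
  let ?p = "letter_map (\<lambda>i. i div 2) (cylinder S) S"
  have div: "map (\<lambda>i. i div 2) w \<in> S" if "w \<in> cylinder S" for w
    using that by (simp add: cylinder_def)
  have p: "?p \<in> hom sSet (word_sset (cylinder S)) (word_sset S)"
    by (rule letter_map_hom[OF D S div])
  have pW: "?p \<in> W"
    by (rule trivial_fibrationI[OF C M p]) (use K cylinder_projection_lifting[OF S] in auto)
  have sect: "letter_map s S (cylinder S) \<in> W \<and>
      letter_map s S (cylinder S) \<in> hom sSet (word_sset S) (word_sset (cylinder S))"
    if s: "\<And>i. s i div 2 = i" for s
  proof -
    have sS: "map s w \<in> cylinder S" if "w \<in> S" for w
      using that s by (simp add: cylinder_def comp_def)
    note sh = letter_map_hom[OF S D sS]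
    have ps: "?p \<cdot>\<^bsub>sSet\<^esub> letter_map s S (cylinder S) = Idn sSet (word_sset S)"
      using letter_map_comp[OF S D S sS div] letter_map_id[OF S, of "(\<lambda>i. i div 2) \<circ> s"] s
      by (simp add: comp_def)
    have "Idn sSet (word_sset S) \<cdot>\<^bsub>sSet\<^esub> ?p = ?p" using hom_id[OF C p] by simp
    moreover have Ih: "Idn sSet (word_sset S) \<in> hom sSet (word_sset S) (word_sset S)"
      using id_hom[OF C] hom_Ob[OF C p] by blast
    ultimately have "Idn sSet (word_sset S) \<in> W"
      using weq_cancel_right[OF M p Ih pW] pW by simp
    then show ?thesis using weq_cancel_left[OF M sh p pW] ps sh by simp
  qed
  \<comment> \<open>the homotopy on vertices: the identity at one end of the cylinder, the retraction at the other\<close>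
  define \<eta> where "\<eta> i = (if even i then i div 2 else retract_letter (i div 2))" for i
  have eta: "map \<eta> w \<in> absorbing_words" if w: "w \<in> cylinder S" for w
  proof -
    have a: "map (\<lambda>i. i div 2) w \<in> absorbing_words" using div[OF w] sub by blast
    have two: "\<eta> i = 2 \<longleftrightarrow> i div 2 = 2" for i by (auto simp: \<eta>_def retract_letter_def)
    have "sorted_wrt (\<lambda>a b. \<eta> a = 2 \<longrightarrow> \<eta> b = 2) w"
      using a unfolding two by (simp add: absorbing_words_def sorted_wrt_map)
    moreover have "\<eta> i \<in> {0, 1, 2}" if "i \<in> set w" for i
    proof -
      have "i div 2 \<in> {0, 1, 2}" using a that unfolding absorbing_words_def by fastforce
      then show ?thesis by (auto simp: \<eta>_def retract_letter_def)
    qed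
    then have "set (map \<eta> w) \<subseteq> {0, 1, 2}" unfolding set_map by (rule image_subsetI)
    ultimately show ?thesis using a by (simp add: absorbing_words_def sorted_wrt_map)
  qed
  let ?H = "smap_of (cylinder S) Y (\<lambda>x. N (map \<eta> x))"
  have Hw: "word_map (cylinder S) Y (\<lambda>x. N (map \<eta> x))" by (rule word_map_comp[OF N(1) D eta])
  have H: "?H \<in> hom sSet (word_sset (cylinder S)) Y" by (rule smap_of_hom[OF D Y(2) Hw])
  have H0: "?H \<cdot>\<^bsub>sSet\<^esub> letter_map (\<lambda>i. 2 * i) S (cylinder S) = k"
  proof -
    have "?H \<cdot>\<^bsub>sSet\<^esub> letter_map (\<lambda>i. 2 * i) S (cylinder S)
      = smap_of S Y (\<lambda>x. N (map \<eta> (map (\<lambda>i. 2 * i) x)))"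
      by (rule comp_letter_map[OF S D _ Y(2) Hw]) (simp add: cylinder_def comp_def)
    also have "\<dots> = k" unfolding G(2) using N(2) by (intro smap_of_cong) (simp add: \<eta>_def comp_def)
    finally show ?thesis .
  qed
  have H1: "?H \<cdot>\<^bsub>sSet\<^esub> letter_map (\<lambda>i. 2 * i + 1) S (cylinder S) = k \<cdot>\<^bsub>sSet\<^esub> letter_map retract_letter S S"
  proof -
    have rSS: "map retract_letter x \<in> S" if "x \<in> S" for x using rS[OF that] sub(1) by blast
    have "?H \<cdot>\<^bsub>sSet\<^esub> letter_map (\<lambda>i. 2 * i + 1) S (cylinder S)
      = smap_of S Y (\<lambda>x. N (map \<eta> (map (\<lambda>i. 2 * i + 1) x)))"
      by (rule comp_letter_map[OF S D _ Y(2) Hw]) (simp add: cylinder_def comp_def)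
    also have "\<dots> = smap_of S Y (\<lambda>x. G (map retract_letter x))"
      using N(2)[OF rSS] by (intro smap_of_cong) (simp add: \<eta>_def comp_def)
    also have "\<dots> = k \<cdot>\<^bsub>sSet\<^esub> letter_map retract_letter S S"
      unfolding G(2) by (rule comp_letter_map[OF S S rSS Y(2) G(1), symmetric])
    finally show ?thesis .
  qed
  have s0: "2 * i div 2 = i" and s1: "(2 * i + 1) div 2 = i" for i :: nat by auto
  have "?H \<in> W"
    using weq_cancel_right[OF M _ H] sect[OF s0] H0 k(2) by metis
  then have "k \<cdot>\<^bsub>sSet\<^esub> letter_map retract_letter S S \<in> W"
    using weq_comp[OF M _ H] sect[OF s1] H1 by metis
  then have "letter_map retract_letter S S \<in> W" by (rule weq_cancel_left[OF M grh k])
  with gr show ?thesis by (intro weq_split_mono[OF C M g r rg]) simp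
qed

end

section \<open>The thickened outer horn\<close>

text \<open>
  The outer horn \<open>\<Lambda>\<^sup>2\<^sub>0\<close> whose edge from \<open>0\<close> to \<open>1\<close> has been enlarged to the nerve of \<open>0 \<cong> 1\<close>, and the result
  of filling it.
\<close>

definition horn_shape :: "nat list set" where
  "horn_shape = {w. w \<noteq> [] \<and> set w \<subseteq> {0, 1}} \<union> {w. w \<noteq> [] \<and> sorted w \<and> set w \<subseteq> {0, 2}}"

definition filled_shape :: "nat list set" where
  "filled_shape = {w. w \<noteq> [] \<and> set w \<subseteq> {0, 1}} \<union> {w. w \<noteq> [] \<and> sorted w \<and> set w \<subseteq> {0, 1, 2}}"

text \<open>
  Both shapes occur among the stages, but for different values of \<open>c\<close>: the filled shape contains
  \<open>12\<close> but not \<open>102\<close>, so it is a stage in the filling process that starts from the edge \<open>12\<close> and not in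
  the one that starts from \<open>02\<close>.
\<close>

lemma horn_shape_stage: "horn_shape = stage 0 1"
proof -
  have a: "alternating 0 1 i = (if i = 0 then 0 else 2)"
    "alternating 0 (Suc 0) i = (if i = 0 then 0 else 2)" for i
    by (simp_all add: alternating_def)
  have "w \<in> map (alternating 0 1) ` simplex_words 1"
    if w: "w \<noteq> []" "sorted w" "set w \<subseteq> {0, 2}" for w
  proof
    show "w = map (alternating 0 1) (map (\<lambda>i. i div 2) w)"
      using w(3) unfolding map_map by (intro map_idI[symmetric]) (auto simp: a)
    have "sorted (map (\<lambda>i. i div 2) w)"
      using w(2) unfolding sorted_map by (rule sorted_wrt_mono_rel[rotated]) (simp add: div_le_mono)
    with w show "map (\<lambda>i. i div 2) w \<in> simplex_words 1" by (auto simp: simplex_words_def)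
  qed
  moreover have "map (alternating 0 1) y \<noteq> [] \<and> sorted (map (alternating 0 1) y) \<and>
      set (map (alternating 0 1) y) \<subseteq> {0, 2}" if y: "y \<in> simplex_words 1" for y
  proof -
    have "sorted (map (alternating 0 1) y)"
      using y unfolding sorted_map simplex_words_def
      by (auto intro: sorted_wrt_mono_rel[rotated] simp: a)
    with y show ?thesis by (auto simp: simplex_words_def a)
  qed
  ultimately show ?thesis unfolding horn_shape_def stage_def by blast
qed

lemma filled_shape_stage: "filled_shape = stage 1 2"
proof -
  have "map (alternating 1 2) y = y" if "set y \<subseteq> {0..2}" for y
  proof (rule map_idI)
    fix i assume "i \<in> set y"
    then have "i = 0 \<or> i = 1 \<or> i = 2" using that by auto
    then show "alternating 1 2 i = i" by (auto simp: alternating_def)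
  qed
  then have "map (alternating 1 2) ` simplex_words 2 = simplex_words 2"
    by (force simp: simplex_words_def image_iff)
  moreover have "{0..2} = {0, 1, 2::nat}" by auto
  ultimately show ?thesis unfolding filled_shape_def stage_def simplex_words_def by simp
qed

lemma word_closed_shapes: "word_closed horn_shape" "word_closed filled_shape"
  by (simp_all add: horn_shape_stage filled_shape_stage word_closed_stage)

lemma shapes_subset:
  "arrow_words \<subseteq> horn_shape" "horn_shape \<subseteq> filled_shape" "filled_shape \<subseteq> absorbing_words"
proof -
  have "w \<in> absorbing_words" if "w \<noteq> []" "set w \<subseteq> {0, 1}" for w
  proof -
    have "sorted_wrt (\<lambda>a b. True) w" by (simp add: sorted_wrt_iff_nth_less)
    then have "sorted_wrt (\<lambda>a b. a = 2 \<longrightarrow> b = 2) w"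
      by (rule sorted_wrt_mono_rel[rotated]) (use that in fastforce)
    with that show ?thesis by (auto simp: absorbing_words_def)
  qed
  then show "filled_shape \<subseteq> absorbing_words"
    using absorbing_sortedI by (auto simp: filled_shape_def)
qed (auto simp: arrow_words_def horn_shape_def filled_shape_def)

lemma filled_minus_horn_shape:
  assumes "w \<in> filled_shape" "w \<notin> horn_shape"
  shows "sorted w \<and> 1 \<in> set w \<and> 2 \<in> set w"
  using assms by (auto simp: filled_shape_def horn_shape_def)

lemma edge_not_in_horn_shape: "[1, 2] \<notin> horn_shape"
  by (simp add: horn_shape_def)

text \<open>
  A simplex \<open>w\<close> that lies outside is sorted and has vertices \<open>1\<close> and \<open>2\<close>, hence an edge \<open>12\<close>. It
  suffices to find such an edge within the horn, that is, one that together with \<open>k\<close> does not use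
  up all vertices. If \<open>w\<close> takes the value \<open>0\<close> at \<open>k\<close>, then the initial vertex remains unused; otherwise
  \<open>k\<close> itself can be chosen as an end of the edge.
\<close>

lemma inner_horn_detects_horn_shape:
  assumes w: "w \<in> filled_shape" "length w = Suc n" and k: "0 < k" "k < n"
    and horn: "\<And>x. x \<in> horn_words n k \<Longrightarrow> map (nth w) x \<in> horn_shape"
  shows "w \<in> horn_shape"
proof (rule ccontr)
  assume "w \<notin> horn_shape"
  with filled_minus_horn_shape[OF w(1)] have s: "sorted w" and 1: "1 \<in> set w" and 2: "2 \<in> set w"
    by auto
  have "set w \<subseteq> {0, 1, 2}" using w(1) by (auto simp: filled_shape_def)
  then have w012: "w ! i \<in> {0, 1, 2}" if "i \<le> n" for i
    using that w(2) by (elim subsetD) simp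
  have edge: False
    if pq: "p \<le> n" "q \<le> n" "w ! p = 1" "w ! q = 2" and j: "j \<le> n" "j \<noteq> k" "j \<notin> {p, q}" for p q j
  proof -
    have "p \<le> q" using s pq w(2) sorted_nth_mono[OF s, of q p] by (cases "p \<le> q") auto
    then have "[p, q] \<in> horn_words n k"
      using pq j by (auto simp: horn_words_def simplex_words_def)
    from horn[OF this] pq show False using edge_not_in_horn_shape by simp
  qed
  obtain p q where p: "p \<le> n" "w ! p = 1" and q: "q \<le> n" "w ! q = 2"
    using 1 2 w(2) by (auto simp: in_set_conv_nth less_Suc_eq_le)
  consider "w ! k = 0" | "w ! k = 1" | "w ! k = 2" using w012[of k] k by auto
  then show False
  proof cases
    case 1
    then have "w ! 0 = 0" using sorted_nth_mono[OF s, of 0 k] k w(2) by simp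
    then have "p \<noteq> 0" "q \<noteq> 0" using p q by (metis zero_neq_one, metis zero_neq_numeral)
    then show False using edge[OF p(1) q(1) p(2) q(2), of 0] k by simp
  next
    case 2
    then show False using edge[of k q 0] edge[of k q n] q k by force
  next
    case 3
    then show False using edge[of p k 0] edge[of p k n] p k by force
  qed
qed

context word_encoding
begin

text \<open>
  The inclusion is an inner fibration: by the previous lemma the map on the simplex already takes
  values in the smaller shape.
\<close>

lemma inner_horn_lifting_horn_shape:
  fixes i :: "'u smap"
  assumes i: "i \<in> inner_horn_inclusions"
  shows "has_lifting sSet i (inclusion horn_shape filled_shape)"
proof -
  let ?f = "inclusion horn_shape filled_shape"
  note f = inclusion_hom[OF word_closed_shapes shapes_subset(2)]
  note fm = inclusion_mono[OF word_closed_shapes shapes_subset(2)]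
  obtain n k a b where iA: "i \<in> Ar sSet" and k: "0 < k" "k < n"
    and a: "sset_iso (horn n k) (src i) a" and b: "sset_iso (std_simplex n) (trg i) b"
    and ab: "\<And>m x. x \<in> simplices (horn n k) m \<Longrightarrow> fn i m (a m x) = b m x"
    using i unfolding inner_horn_inclusions_def by blast
  then have ih: "i \<in> hom sSet (src i) (trg i)" by (simp add: hom_def sSet_simps)
  show ?thesis
  proof (rule liftingI[OF ih f])
    fix u v assume u: "u \<in> hom sSet (src i) (word_sset horn_shape)"
      and v: "v \<in> hom sSet (trg i) (word_sset filled_shape)" and uv: "?f \<cdot>\<^bsub>sSet\<^esub> u = v \<cdot>\<^bsub>sSet\<^esub> i"
    let ?t = "[0..<Suc n]"
    have t: "?t \<in> simplices (std_simplex n) n"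
      by (auto simp: std_simplex_def ord_maps_def simp del: upt_Suc)
    have bt: "b n ?t \<in> simplices (trg i) n"
      using b t by (auto simp: sset_iso_def bij_betw_def)
    obtain w where w: "fn v n (b n ?t) = e w" "w \<in> filled_shape" "length w = Suc n"
      using fn_simplex[OF v bt] by (auto simp: simplices_word_sset)
    have vb: "fn v m (b m x) = e (map (nth w) x)" if x: "x \<in> simplices (std_simplex n) m" for m x
    proof -
      have xo: "x \<in> ord_maps m n" using x by (simp add: std_simplex_def)
      then have "map (nth ?t) x = x"
        by (intro map_idI) (auto simp: ord_maps_def less_Suc_eq_le simp del: upt_Suc)
      then have "b m x = act (trg i) n x (b n ?t)"
        using b xo t unfolding sset_iso_def sset_map_def by (metis std_simplex_def sset.select_convs(2))
      then show ?thesis using fn_act[OF v xo bt] w by simp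
    qed
    have "w \<in> horn_shape"
    proof (rule inner_horn_detects_horn_shape[OF w(2,3) k])
      fix x assume x: "x \<in> horn_words n k"
      then obtain m where m: "length x = Suc m"
        by (cases x) (auto simp: horn_words_def simplex_words_def)
      with x have xh: "x \<in> simplices (horn n k) m" by (simp add: simplices_horn)
      have xs: "x \<in> simplices (std_simplex n) m"
        using x m by (simp add: simplices_std_simplex horn_words_def)
      have ax: "a m x \<in> simplices (src i) m" using a xh by (auto simp: sset_iso_def bij_betw_def)
      have "e (map (nth w) x) = fn v m (fn i m (a m x))" using vb[OF xs] ab[OF xh] by simp
      also have "\<dots> = fn ?f m (fn u m (a m x))"
        using uv fn_comp[OF ih ax, of v] fn_comp[OF u ax, of ?f] by simp
      also have "\<dots> = fn u m (a m x)" by (rule fn_inclusion[OF fn_simplex[OF u ax]])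
      finally have "e (map (nth w) x) \<in> simplices (word_sset horn_shape) m"
        using fn_simplex[OF u ax] by simp
      then show "map (nth w) x \<in> horn_shape" by simp
    qed
    then have "fn v m z \<in> simplices (word_sset horn_shape) m" if z: "z \<in> simplices (trg i) m" for m z
    proof -
      have "b m ` simplices (std_simplex n) m = simplices (trg i) m"
        using b by (simp add: sset_iso_def bij_betw_def)
      then obtain x where x: "x \<in> simplices (std_simplex n) m" "z = b m x" using z by blast
      then have "x \<in> ord_maps m (length w - 1)" using w by (simp add: std_simplex_def)
      from word_closedD[OF word_closed_shapes(1) \<open>w \<in> horn_shape\<close> this] show ?thesis
        using vb[OF x(1)] x by (simp add: simplices_std_simplex)
    qed
    from inclusion_factor[OF word_closed_shapes shapes_subset(2) v this] obtain h where
      h: "h \<in> hom sSet (trg i) (word_sset horn_shape)" "?f \<cdot>\<^bsub>sSet\<^esub> h = v" by blast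
    have "?f \<cdot>\<^bsub>sSet\<^esub> (h \<cdot>\<^bsub>sSet\<^esub> i) = ?f \<cdot>\<^bsub>sSet\<^esub> u"
      using hom_assoc[OF is_category_sSet ih h(1) f] h(2) uv by simp
    from mono_cancel[OF fm f hom_comp[OF is_category_sSet ih h(1)] u this] h
    show "\<exists>h \<in> hom sSet (trg i) (word_sset horn_shape). h \<cdot>\<^bsub>sSet\<^esub> i = u \<and> ?f \<cdot>\<^bsub>sSet\<^esub> h = v"
      by blast
  qed
qed

text \<open>
  If it were inner anodyne, it would lift against itself and thus be surjective, but it misses the
  edge \<open>12\<close>.
\<close>

lemma not_inner_anodyne_horn_shape: "\<not> inner_anodyne (inclusion horn_shape filled_shape)"
proof
  let ?f = "inclusion horn_shape filled_shape :: 'u smap"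
  let ?A = "word_sset horn_shape" and ?B = "word_sset filled_shape"
  note C = is_category_sSet
  note f = inclusion_hom[OF word_closed_shapes shapes_subset(2)]
  note fm = inclusion_mono[OF word_closed_shapes shapes_subset(2)]
  assume "inner_anodyne ?f"
  moreover have "inner_horn_inclusions \<subseteq> {i \<in> Ar sSet. has_lifting sSet i ?f}"
  proof
    fix i :: "'u smap" assume i: "i \<in> inner_horn_inclusions"
    then have "i \<in> Ar sSet" by (simp add: inner_horn_inclusions_def)
    with inner_horn_lifting_horn_shape[OF i] show "i \<in> {i \<in> Ar sSet. has_lifting sSet i ?f}"
      by simp
  qed
  ultimately have "has_lifting sSet ?f ?f"
    using saturated_lifting_mono[OF C fm] unfolding inner_anodyne_def saturated_hull_def by blast
  note ff = this
  have A: "Idn sSet ?A \<in> hom sSet ?A ?A" and B: "Idn sSet ?B \<in> hom sSet ?B ?B"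
    using hom_Ob[OF C f] id_hom[OF C] by auto
  have "?f \<cdot>\<^bsub>sSet\<^esub> Idn sSet ?A = Idn sSet ?B \<cdot>\<^bsub>sSet\<^esub> ?f"
    using hom_id[OF C f] by simp
  from liftingD[OF ff f f A B this] obtain h where
    h: "h \<in> hom sSet ?B ?A" "?f \<cdot>\<^bsub>sSet\<^esub> h = Idn sSet ?B" .
  have x: "e [1, 2] \<in> simplices ?B 1" by (simp add: filled_shape_def)
  have "fn h 1 (e [1, 2]) = fn (Idn sSet ?B) 1 (e [1, 2])"
    using fn_comp[OF h(1) x, of ?f] fn_inclusion[OF fn_simplex[OF h(1) x]] h(2) by simp
  also have "\<dots> = e [1, 2]" using x by (simp add: sSet_def)
  finally have "e [1, 2] \<in> simplices ?A 1" using fn_simplex[OF h(1) x] by simp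
  then show False using edge_not_in_horn_shape by simp
qed

text \<open>
  Two out of three, as the interval \<open>02\<close> is included into each of the two shapes by a weak
  equivalence.
\<close>

lemma weak_categorical_equivalence_horn_shape:
  "weak_categorical_equivalence (inclusion horn_shape filled_shape)"
  unfolding weak_categorical_equivalence_def
proof (intro conjI allI impI)
  note f = inclusion_hom[OF word_closed_shapes shapes_subset(2)]
  then show "inclusion horn_shape filled_shape \<in> Ar sSet" by (rule hom_Ar)
  fix W K F :: "'u smap set" assume J: "joyal_model_structure W K F"
  then have M: "model_structure sSet W K F" unfolding joyal_model_structure_def by blast
  have "\<exists>G'. word_map absorbing_words Y G' \<and> (\<forall>w \<in> horn_shape. G' w = G w)"
    if "quasi_category Y" "word_map horn_shape Y G" for Y :: "'u sset" and G
    by (rule extend_stage[OF that(1) _ _ that(2)[unfolded horn_shape_stage]])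
      (simp, simp, unfold horn_shape_stage, blast)
  then have A: "inclusion arrow_words horn_shape \<in> W"
    using shapes_subset by (intro arrow_inclusion_weq[OF J word_closed_shapes(1)]) auto
  have "\<exists>G'. word_map absorbing_words Y G' \<and> (\<forall>w \<in> filled_shape. G' w = G w)"
    if "quasi_category Y" "word_map filled_shape Y G" for Y :: "'u sset" and G
    by (rule extend_stage[OF that(1) _ _ that(2)[unfolded filled_shape_stage]])
      (simp, simp, unfold filled_shape_stage, blast)
  then have B: "inclusion arrow_words filled_shape \<in> W"
    using shapes_subset by (intro arrow_inclusion_weq[OF J word_closed_shapes(2)]) auto
  have "inclusion horn_shape filled_shape \<cdot>\<^bsub>sSet\<^esub> inclusion arrow_words horn_shape =
      inclusion arrow_words filled_shape"
    using letter_map_comp[OF word_closed_arrow word_closed_shapes, of id id] shapes_subset by auto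
  with weq_cancel_right[OF M inclusion_hom[OF word_closed_arrow word_closed_shapes(1) shapes_subset(1)] f A] B
  show "inclusion horn_shape filled_shape \<in> W" by simp
qed

lemma bijective_on_vertices_horn_shape:
  "bijective_on_vertices (inclusion horn_shape filled_shape)"
proof -
  have "word_sset horn_shape = src (inclusion horn_shape filled_shape)"
    "word_sset filled_shape = trg (inclusion horn_shape filled_shape)"
    by (simp_all add: letter_map_def smap_of_def)
  moreover have "{x \<in> horn_shape. length x = Suc 0} = {x \<in> filled_shape. length x = Suc 0}"
    by (auto simp: horn_shape_def filled_shape_def length_Suc_conv)
  then have "simplices (word_sset horn_shape) 0 = simplices (word_sset filled_shape) 0"
    by (simp add: simplices_word_sset)
  moreover have "bij_betw (fn (inclusion horn_shape filled_shape) 0)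
      (simplices (word_sset horn_shape) 0) (simplices (word_sset horn_shape) 0)"
    using fn_inclusion by (intro bij_betw_cong[THEN iffD2, OF _ bij_betw_id]) auto
  ultimately show ?thesis by (simp add: bijective_on_vertices_def)
qed

end

theorem theorem4:
  assumes "large_universe TYPE('u)"
  shows "\<exists>f :: 'u smap. f \<in> Ar sSet \<and> monomorphism sSet f \<and> bijective_on_vertices f \<and>
           weak_categorical_equivalence f \<and> \<not> inner_anodyne f"
proof -
  have "infinite (UNIV :: 'u set)" using assms by (simp add: large_universe_def)
  then obtain c :: "nat \<Rightarrow> 'u" where "inj c" using infinite_countable_subset by blast
  then have "inj (c \<circ> list_encode)" by (rule inj_compose) (rule inj_list_encode)
  then interpret word_encoding "c \<circ> list_encode" by unfold_locales
  let ?f = "inclusion horn_shape filled_shape"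
  have "?f \<in> Ar sSet" using inclusion_hom[OF word_closed_shapes shapes_subset(2)] by (rule hom_Ar)
  then show ?thesis
    using inclusion_mono[OF word_closed_shapes shapes_subset(2)] bijective_on_vertices_horn_shape
      weak_categorical_equivalence_horn_shape not_inner_anodyne_horn_shape by blast
qed

end
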